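(* Let $m\ge 2$ and $d\ge 1$ be integers. Let $\mu=\sum_{k=1}^m\pi_k(\mu_{k1}\times\mu_{k2}\times\cdots\times\mu_{kd})$ be a probability measure on $\mathbb{R}^d$, where $\pi_k>0$, $\sum_{k=1}^m\pi_k=1$, and each $\mu_{kj}$ is a probability measure on $\mathbb{R}$. If there exists a partition $S_1,S_2,S_3$ of $[d]$ satisfying $$\tau_\mu(S_1)+\tau_\mu(S_2)+\tau_\mu(S_3)\ge 2m+2,$$ then $\mu$ is identifiable. Conversely, there exists a non-identifiable probability measure $\mu$ on $\mathbb{R}^d$ of the form $\mu=\sum_{k=1}^m\pi_k(\mu_{k1}\times\mu_{k2}\times\cdots\times\mu_{kd})$, with $\pi_k>0$, $\sum_{k=1}^m\pi_k=1$, and each $\mu_{kj}$ a probability measure on $\mathbb{R}$, such that for every partition $S_1,S_2,S_3$ of $[d]$, $$\tau_\mu(S_1)+\tau_\mu(S_2)+\tau_\mu(S_3)\le 2m+1.$$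
   Context: Notation: $[n]=\{1,\dots,n\}$. The number of components $m$ is known and fixed. Identifiability: $\mu=\sum_{k=1}^m\pi_k(\mu_{k1}\times\cdots\times\mu_{kd})$ is identifiable if, whenever $\tilde\mu=\sum_{k=1}^m\tilde\pi_k(\tilde\mu_{k1}\times\cdots\times\tilde\mu_{kd})$ (with $\tilde\pi_k>0$, $\sum_k\tilde\pi_k=1$, and $\tilde\mu_{kj}$ probability measures on $\mathbb{R}$) satisfies $\tilde\mu=\mu$, there exists a permutation $\sigma:[m]\to[m]$ such that $\pi_k=\tilde\pi_{\sigma(k)}$ and $\mu_{kj}=\tilde\mu_{\sigma(k)j}$ for all $k\in[m]$, $j\in[d]$. $\ell$-independence (relative to the given representation of $\mu$): the $j$-th variable is $\ell$-independent if every subfamily of cardinality $\ell$ of the indexed family $\{\mu_{kj}\}_{k=1}^m$ is linearly independent (as signed measures over $\mathbb{R}$). Let $\mathbf{Ind}_\mu(j)=\max\{\ell:\ j\text{-th variable is }\ell\text{-independent}\}$. For $S\subseteq[d]$, let $\mathbf{Ind}_\mu(S)=\sum_{j\in S}\mathbf{Ind}_\mu(j)$ and $$\tau_\mu(S)=\min\{m,\ \mathbf{Ind}_\mu(S)-|S|+1\}.$$ *)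

theory Defs
  imports "HOL-Probability.Probability" "HOL-Combinatorics.Permutations"
begin

text \<open>
  Euclidean space \<open>\<real>\<^sup>d\<close> is the finite product \<open>Pi\<^sub>M {1..d} (\<lambda>_. borel)\<close>. A representation of a
  mixture of \<open>m\<close> product measures on it consists of weights \<open>w k\<close> and marginals \<open>M k j\<close>, where only
  the values at \<open>k \<in> {1..m}\<close> and \<open>j \<in> {1..d}\<close> matter.
\<close>

definition mixture_rep ::
  "nat \<Rightarrow> nat \<Rightarrow> (nat \<Rightarrow> real) \<Rightarrow> (nat \<Rightarrow> nat \<Rightarrow> real measure) \<Rightarrow> bool" where
  "mixture_rep m d w M \<longleftrightarrow>
     (\<forall>k\<in>{1..m}. w k > 0) \<and> (\<Sum>k\<in>{1..m}. w k) = 1 \<and>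
     (\<forall>k\<in>{1..m}. \<forall>j\<in>{1..d}. prob_space (M k j) \<and> sets (M k j) = sets borel)"

definition mixture ::
  "nat \<Rightarrow> nat \<Rightarrow> (nat \<Rightarrow> real) \<Rightarrow> (nat \<Rightarrow> nat \<Rightarrow> real measure) \<Rightarrow> (nat \<Rightarrow> real) measure" where
  "mixture m d w M =
     measure_of (space (Pi\<^sub>M {1..d} (\<lambda>_. borel :: real measure)))
       (sets (Pi\<^sub>M {1..d} (\<lambda>_. borel :: real measure)))
       (\<lambda>A. \<Sum>k\<in>{1..m}. ennreal (w k) * emeasure (Pi\<^sub>M {1..d} (M k)) A)"

definition identifiable ::
  "nat \<Rightarrow> nat \<Rightarrow> (nat \<Rightarrow> real) \<Rightarrow> (nat \<Rightarrow> nat \<Rightarrow> real measure) \<Rightarrow> bool" where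
  "identifiable m d w M \<longleftrightarrow>
     (\<forall>w' M'. mixture_rep m d w' M' \<and> mixture m d w' M' = mixture m d w M \<longrightarrow>
        (\<exists>\<sigma>. \<sigma> permutes {1..m} \<and>
             (\<forall>k\<in>{1..m}. w k = w' (\<sigma> k) \<and> (\<forall>j\<in>{1..d}. M k j = M' (\<sigma> k) j))))"

text \<open>
  Linear independence over the reals of the indexed family \<open>(N k)\<close>, \<open>k \<in> K\<close>, in the space of finite
  signed Borel measures on the line. Since the family is indexed, a repeated measure makes it
  dependent.
\<close>

definition lin_indep_measures :: "nat set \<Rightarrow> (nat \<Rightarrow> real measure) \<Rightarrow> bool" where
  "lin_indep_measures K N \<longleftrightarrow>
     (\<forall>c :: nat \<Rightarrow> real.
        (\<forall>A\<in>sets borel. (\<Sum>k\<in>K. c k * measure (N k) A) = 0) \<longrightarrow> (\<forall>k\<in>K. c k = 0))"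

definition l_independent ::
  "nat \<Rightarrow> (nat \<Rightarrow> nat \<Rightarrow> real measure) \<Rightarrow> nat \<Rightarrow> nat \<Rightarrow> bool" where
  "l_independent m M l j \<longleftrightarrow>
     (\<forall>K. K \<subseteq> {1..m} \<and> card K = l \<longrightarrow> lin_indep_measures K (\<lambda>k. M k j))"

text \<open>
  For \<open>l > m\<close> there are no subfamilies of cardinality \<open>l\<close> and \<open>l\<close>-independence would hold vacuously,
  so the maximum ranges over \<open>l \<le> m\<close>.
\<close>

definition Ind_var :: "nat \<Rightarrow> (nat \<Rightarrow> nat \<Rightarrow> real measure) \<Rightarrow> nat \<Rightarrow> nat" where
  "Ind_var m M j = Max {l. l \<le> m \<and> l_independent m M l j}"

definition Ind_set :: "nat \<Rightarrow> (nat \<Rightarrow> nat \<Rightarrow> real measure) \<Rightarrow> nat set \<Rightarrow> nat" where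
  "Ind_set m M S = (\<Sum>j\<in>S. Ind_var m M j)"

definition tau :: "nat \<Rightarrow> (nat \<Rightarrow> nat \<Rightarrow> real measure) \<Rightarrow> nat set \<Rightarrow> int" where
  "tau m M S = min (int m) (int (Ind_set m M S) - int (card S) + 1)"

text \<open>
  Parts may be empty. An empty part has \<open>tau\<close> equal to \<open>1\<close> (for \<open>m \<ge> 1\<close>), so the three values then
  sum to at most \<open>2 * m + 1\<close>.
\<close>

definition partition3 :: "nat set \<Rightarrow> nat set \<Rightarrow> nat set \<Rightarrow> nat set \<Rightarrow> bool" where
  "partition3 D S1 S2 S3 \<longleftrightarrow>
     S1 \<union> S2 \<union> S3 = D \<and> S1 \<inter> S2 = {} \<and> S1 \<inter> S3 = {} \<and> S2 \<inter> S3 = {}"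

lemma space_mixture: "space (mixture m d w M) = space (Pi\<^sub>M {1..d} (\<lambda>_. borel :: real measure))"
  by (simp add: mixture_def)

lemma sets_mixture: "sets (mixture m d w M) = sets (Pi\<^sub>M {1..d} (\<lambda>_. borel :: real measure))"
  by (simp add: mixture_def)

lemma emeasure_mixture:
  assumes "mixture_rep m d w M"
    and A: "A \<in> sets (Pi\<^sub>M {1..d} (\<lambda>_. borel :: real measure))"
  shows "emeasure (mixture m d w M) A =
    (\<Sum>k\<in>{1..m}. ennreal (w k) * emeasure (Pi\<^sub>M {1..d} (M k)) A)"
proof -
  let ?P = "Pi\<^sub>M {1..d} (\<lambda>_. borel :: real measure)"
  let ?f = "\<lambda>A. \<Sum>k\<in>{1..m}. ennreal (w k) * emeasure (Pi\<^sub>M {1..d} (M k)) A"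
  have S: "sets (Pi\<^sub>M {1..d} (M k)) = sets ?P" if "k \<in> {1..m}" for k
    using assms(1) that by (intro sets_PiM_cong) (auto simp: mixture_rep_def)
  have "countably_additive (sets ?P) ?f"
  proof (rule countably_additiveI)
    fix F :: "nat \<Rightarrow> (nat \<Rightarrow> real) set"
    assume F: "range F \<subseteq> sets ?P" "disjoint_family F"
    have "(\<Sum>i. ?f (F i)) = (\<Sum>k\<in>{1..m}. \<Sum>i. ennreal (w k) * emeasure (Pi\<^sub>M {1..d} (M k)) (F i))"
      by (rule suminf_sum) simp
    also have "\<dots> = ?f (\<Union>i. F i)"
      using F S by (intro sum.cong refl) (simp add: suminf_emeasure)
    finally show "(\<Sum>i. ?f (F i)) = ?f (\<Union>i. F i)" .
  qed
  moreover have "positive (sets ?P) ?f"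
    by (simp add: positive_def)
  ultimately show ?thesis
    using A by (intro emeasure_measure_of[OF mixture_def])
      (auto simp: sets_mixture dest: sets.sets_into_space)
qed

lemma prob_space_mixture:
  assumes R: "mixture_rep m d w M"
  shows "prob_space (mixture m d w M)"
proof (rule prob_spaceI)
  let ?P = "Pi\<^sub>M {1..d} (\<lambda>_. borel :: real measure)"
  have E: "emeasure (Pi\<^sub>M {1..d} (M k)) (space ?P) = 1" if k: "k \<in> {1..m}" for k
  proof -
    have "prob_space (Pi\<^sub>M {1..d} (M k))"
      using R k by (intro prob_space_PiM) (auto simp: mixture_rep_def)
    moreover have "sets (Pi\<^sub>M {1..d} (M k)) = sets ?P"
      using R k by (intro sets_PiM_cong) (auto simp: mixture_rep_def)
    ultimately show ?thesis
      using prob_space.emeasure_space_1 sets_eq_imp_space_eq by metis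
  qed
  have "emeasure (mixture m d w M) (space ?P) = (\<Sum>k\<in>{1..m}. ennreal (w k))"
    by (simp only: emeasure_mixture[OF R sets.top] E mult_1_right cong: sum.cong)
  also have "\<dots> = ennreal (\<Sum>k\<in>{1..m}. w k)"
    using R by (intro sum_ennreal) (auto simp: mixture_rep_def less_imp_le)
  finally show "emeasure (mixture m d w M) (space (mixture m d w M)) = 1"
    using R by (simp add: space_mixture mixture_rep_def)
qed

end

theory Submission
  imports Defs "HOL-Library.Function_Algebras"
begin

text \<open>
  Grouping the variables along the partition turns a mixture into a sum of \<open>m\<close> rank-one tensors of
  order three, so identifiability is an instance of Kruskal's uniqueness theorem, once the Kruskal
  rank of the grouped families is known to be at least \<open>\<tau>(S)\<close>. A measure on a product is encoded
  as a function on boxes, and tensors are compared by applying linear functionals. A single estimate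
  of Sylvester type, \<open>tensor_rank_bound\<close>, drives everything: with no terms on the right it gives the
  bound \<open>a + b - 1\<close> for the Kruskal rank of a product of two families and the uniqueness of the
  weights, and applied to slices of the tensor it gives the hypothesis of Kruskal's permutation lemma.
  That lemma is used on each of the three factors, and the three permutations agree because a slice
  that separates two indices would otherwise have incompatible column spaces.

  For the converse all components are equal to one point mass, so every \<open>\<tau>(S)\<close> is \<open>1\<close> and only the
  sum of the weights is determined by \<open>\<mu>\<close>.
\<close>

section \<open>Linear independence of indexed families\<close>

definition lin_indep_family :: "'i set \<Rightarrow> ('i \<Rightarrow> 'a::real_vector) \<Rightarrow> bool" where
  "lin_indep_family K A \<longleftrightarrow> (\<forall>c. (\<Sum>k\<in>K. c k *\<^sub>R A k) = 0 \<longrightarrow> (\<forall>k\<in>K. c k = 0))"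

lemma lin_indep_familyD:
  "lin_indep_family K A \<Longrightarrow> (\<Sum>k\<in>K. c k *\<^sub>R A k) = 0 \<Longrightarrow> \<forall>k\<in>K. c k = 0"
  unfolding lin_indep_family_def by blast

text \<open>A lower bound on the Kruskal rank. Admitting all sizes up to \<open>n\<close>, rather
  than \<open>n\<close> exactly, keeps the bound meaningful on index sets with fewer than
  \<open>n\<close> elements. Finiteness is required because a sum over an infinite set is 0 by
  convention.\<close>

definition krank_ge :: "'i set \<Rightarrow> nat \<Rightarrow> ('i \<Rightarrow> 'a::real_vector) \<Rightarrow> bool" where
  "krank_ge I n A \<longleftrightarrow> (\<forall>K. K \<subseteq> I \<and> finite K \<and> card K \<le> n \<longrightarrow> lin_indep_family K A)"

lemma krank_geD:
  "krank_ge I n A \<Longrightarrow> K \<subseteq> I \<Longrightarrow> finite K \<Longrightarrow> card K \<le> n \<Longrightarrow> lin_indep_family K A"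
  by (auto simp: krank_ge_def)

lemma krank_ge_subset: "krank_ge I n A \<Longrightarrow> K \<subseteq> I \<Longrightarrow> krank_ge K n A"
  by (auto simp: krank_ge_def)

lemma lin_indep_family_subset:
  assumes "lin_indep_family L A" "K \<subseteq> L" "finite L"
  shows "lin_indep_family K A"
  unfolding lin_indep_family_def
proof (intro allI impI)
  fix c assume c: "(\<Sum>k\<in>K. c k *\<^sub>R A k) = 0"
  have "(\<Sum>k\<in>L. (if k \<in> K then c k else 0) *\<^sub>R A k) = (\<Sum>k\<in>K. c k *\<^sub>R A k)"
    using assms by (intro sum.mono_neutral_cong_right) auto
  with c have "\<forall>k\<in>L. (if k \<in> K then c k else 0) = 0"
    by (intro lin_indep_familyD[OF assms(1)]) simp
  with assms(2) show "\<forall>k\<in>K. c k = 0" by force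
qed

lemma lin_indep_family_inj_on:
  assumes "lin_indep_family K A" "finite K"
  shows "inj_on A K"
proof (rule inj_onI, rule ccontr)
  fix k l assume kl: "k \<in> K" "l \<in> K" "A k = A l" "k \<noteq> l"
  have "lin_indep_family {k, l} A"
    using kl by (intro lin_indep_family_subset[OF assms(1) _ assms(2)]) auto
  moreover have "(\<Sum>i\<in>{k, l}. (if i = k then 1 else - 1 :: real) *\<^sub>R A i) = 0"
    using kl by simp
  ultimately have "\<forall>i\<in>{k, l}. (if i = k then 1 else - 1 :: real) = 0"
    by (rule lin_indep_familyD)
  then show False by simp
qed

lemma lin_indep_family_independent:
  assumes "lin_indep_family K A" "finite K"
  shows "independent (A ` K)"
proof (rule real_vector.independent_if_scalars_zero)
  fix c x assume c: "(\<Sum>x\<in>A ` K. c x *\<^sub>R x) = 0" and x: "x \<in> A ` K"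
  have "(\<Sum>k\<in>K. c (A k) *\<^sub>R A k) = 0"
    using c sum.reindex[OF lin_indep_family_inj_on[OF assms], of "\<lambda>x. c x *\<^sub>R x"] by simp
  from lin_indep_familyD[OF assms(1) this] x show "c x = 0" by auto
qed (use assms in auto)

lemma lin_indep_family_not_in_span:
  assumes "lin_indep_family K A" "finite K" "finite R" "card R < card K"
  obtains k where "k \<in> K" "A k \<notin> span R"
proof -
  have "\<not> A ` K \<subseteq> span R"
  proof
    assume "A ` K \<subseteq> span R"
    from real_vector.independent_span_bound[OF assms(3) lin_indep_family_independent[OF assms(1,2)] this]
    show False using card_image[OF lin_indep_family_inj_on[OF assms(1,2)]] assms(4) by simp
  qed
  then show ?thesis using that by auto
qed

lemma lin_indep_family_insert_not_in_span:
  assumes "lin_indep_family (insert l K) A" "finite K" "l \<notin> K"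
  shows "A l \<notin> span (A ` K)"
proof -
  have "A l \<notin> A ` K"
    using lin_indep_family_inj_on[OF assms(1)] assms(2,3) by (auto simp: inj_on_def)
  moreover have "independent (insert (A l) (A ` K))"
    using lin_indep_family_independent[OF assms(1)] assms(2) by simp
  ultimately show ?thesis by (simp add: real_vector.independent_insert)
qed

lemma krank_ge_nonzero:
  assumes "krank_ge I n A" "1 \<le> n" "k \<in> I"
  shows "A k \<noteq> 0"
  using lin_indep_family_insert_not_in_span[of k "{}" A] krank_geD[OF assms(1), of "{k}"] assms
  by auto

text \<open>Purely algebraic separation: a basis \<open>B\<close> of \<open>span S\<close> stays
  independent when \<open>v\<close> is added, so the values of a functional on
  \<open>insert v B\<close> can be prescribed freely. No topology on the space is involved.\<close>

lemma separating_functional: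
  fixes v :: "'a::real_vector"
  assumes "v \<notin> span S"
  obtains f :: "'a \<Rightarrow> real" where "linear f" "\<And>s. s \<in> span S \<Longrightarrow> f s = 0" "f v = 1"
proof -
  obtain B where B: "B \<subseteq> S" "independent B" "S \<subseteq> span B"
    using real_vector.maximal_independent_subset[of S] by blast
  have S: "span S = span B"
    using B by (metis real_vector.span_eq real_vector.span_superset subset_trans)
  with assms have v: "v \<notin> span B" by simp
  then have "independent (insert v B)" using B(2) by (rule real_vector.independent_insertI)
  then obtain f :: "'a \<Rightarrow> real" where f: "linear f" "\<forall>x\<in>insert v B. f x = (if x = v then 1 else 0)"
    using linear_independent_extend[of "insert v B" "\<lambda>x. if x = v then 1 else 0"] by auto
  have "f b = 0" if "b \<in> B" for b
    using f(2) v that real_vector.span_base by fastforce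
  then have "f s = 0" if "s \<in> span B" for s
    using real_vector.linear_eq_0_on_span[OF f(1)] that by blast
  with S have "f s = 0" if "s \<in> span S" for s using that by simp
  with f(1) show ?thesis using f(2) by (intro that[of f]) auto
qed

lemma eq_0_if_functionals_0:
  fixes v :: "'a::real_vector"
  assumes "\<And>f :: 'a \<Rightarrow> real. linear f \<Longrightarrow> f v = 0"
  shows "v = 0"
proof (rule ccontr)
  assume "v \<noteq> 0"
  then obtain f :: "'a \<Rightarrow> real" where "linear f" "f v = 1"
    using separating_functional[of v "{}"] by auto
  with assms show False by force
qed

lemma dual_functional:
  fixes A :: "'i \<Rightarrow> 'a::real_vector"
  assumes "lin_indep_family (insert l K) A" "finite K" "l \<notin> K"
  obtains f :: "'a \<Rightarrow> real" where "linear f" "\<And>k. k \<in> K \<Longrightarrow> f (A k) = 0" "f (A l) = 1"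
  using separating_functional[OF lin_indep_family_insert_not_in_span[OF assms]]
  by (metis imageI real_vector.span_base)

section \<open>Kruskal's theorem\<close>

text \<open>The matrix analogue: a product of two factors through \<open>card K\<close> dimensions
  has rank at least the sum of their ranks minus \<open>card K\<close>, while a sum of
  \<open>card L\<close> rank-one terms has rank at most \<open>card L\<close>. If the bound failed,
  a functional could kill the right-hand side and all terms outside \<open>K2\<close> without
  vanishing on all of \<open>A\<close>, against the independence of \<open>B\<close> on
  \<open>K2\<close>.\<close>

lemma tensor_rank_bound:
  fixes A A' :: "'i \<Rightarrow> 'a::real_vector" and B B' :: "'i \<Rightarrow> 'b::real_vector"
  assumes fin: "finite K" "finite L"
    and A: "krank_ge K a A" and B: "krank_ge K b B"
    and p: "\<And>k. k \<in> K \<Longrightarrow> p k \<noteq> 0"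
    and eq: "\<And>(f :: 'a \<Rightarrow> real) (g :: 'b \<Rightarrow> real). linear f \<Longrightarrow> linear g \<Longrightarrow>
      (\<Sum>k\<in>K. p k * f (A k) * g (B k)) = (\<Sum>k\<in>L. q k * f (A' k) * g (B' k))"
  shows "min a (card K) + min b (card K) \<le> card K + card L"
proof (rule ccontr)
  assume neg: "\<not> ?thesis"
  obtain K1 where K1: "K1 \<subseteq> K" "card K1 = min a (card K)"
    by (meson min.cobounded2 obtain_subset_with_card_n)
  obtain K2 where K2: "K2 \<subseteq> K" "card K2 = min b (card K)"
    by (meson min.cobounded2 obtain_subset_with_card_n)
  have finK: "finite K1" "finite K2" using K1 K2 fin finite_subset by auto
  \<comment> \<open>\<open>R\<close> collects what the functional must kill. It has at most
    \<open>card K - card K2 + card L\<close> elements, fewer than the \<open>card K1\<close>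
    independent vectors of \<open>A\<close>, so one of these lies outside
    \<open>span R\<close>.\<close>
  define R where "R = A ` (K - K2) \<union> A' ` L"
  have "card R \<le> card (K - K2) + card L"
    unfolding R_def using fin by (intro order_trans[OF card_Un_le] add_mono card_image_le) auto
  also have "card (K - K2) = card K - card K2"
    using K2 finK by (simp add: card_Diff_subset)
  finally have "card R < card K1"
    using neg K1 K2 card_mono[OF fin(1) K2(1)] by linarith
  moreover have "lin_indep_family K1 A"
    using K1 finK by (intro krank_geD[OF A]) auto
  moreover have "finite R" using fin by (simp add: R_def)
  ultimately obtain k where k: "k \<in> K1" "A k \<notin> span R"
    using lin_indep_family_not_in_span finK by metis
  from separating_functional[OF k(2)] obtain f :: "'a \<Rightarrow> real"
    where f: "linear f" "\<And>s. s \<in> span R \<Longrightarrow> f s = 0" "f (A k) = 1" by metis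
  have fR: "f s = 0" if "s \<in> R" for s using f(2) that real_vector.span_base by blast
  have "(\<Sum>k\<in>K2. (p k * f (A k)) *\<^sub>R B k) = 0"
  proof (rule eq_0_if_functionals_0)
    fix g :: "'b \<Rightarrow> real" assume g: "linear g"
    have "g (\<Sum>k\<in>K2. (p k * f (A k)) *\<^sub>R B k) = (\<Sum>k\<in>K2. p k * f (A k) * g (B k))"
      by (simp add: linear_sum[OF g] linear_scale[OF g])
    also have "\<dots> = (\<Sum>k\<in>K. p k * f (A k) * g (B k))"
      using K2 fin by (intro sum.mono_neutral_left) (auto intro!: fR simp: R_def)
    also have "\<dots> = (\<Sum>k\<in>L. q k * f (A' k) * g (B' k))" by (rule eq[OF f(1) g])
    also have "\<dots> = 0" using fR by (intro sum.neutral) (auto simp: R_def)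
    finally show "g (\<Sum>k\<in>K2. (p k * f (A k)) *\<^sub>R B k) = 0" .
  qed
  moreover have "lin_indep_family K2 B"
    using K2 finK by (intro krank_geD[OF B]) auto
  ultimately have K2_0: "\<forall>k\<in>K2. p k * f (A k) = 0"
    by (rule lin_indep_familyD[rotated])
  have "f (A i) = 0" if "i \<in> K2" for i
  proof -
    have "p i \<noteq> 0" using that K2(1) by (intro p) auto
    with K2_0 that show ?thesis by auto
  qed
  moreover have "f (A i) = 0" if "i \<in> K - K2" for i using that by (intro fR) (auto simp: R_def)
  ultimately have "f (A k) = 0" using k(1) K1(1) by (cases "k \<in> K2") auto
  with f(3) show False by simp
qed

section \<open>Kruskal's permutation lemma, by counting vectors in flats\<close>

lemma span_insert_exchange:
  fixes v :: "'a::real_vector"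
  assumes "v \<in> span (insert u S)" "v \<notin> span S"
  shows "span (insert v S) = span (insert u S)"
proof -
  have "u \<in> span (insert v S)" using assms by (rule real_vector.in_span_insert)
  then have "span (insert v S) = span (insert u (insert v S))"
    by (rule real_vector.span_redundant[symmetric])
  also have "\<dots> = span (insert v (insert u S))" by (simp add: insert_commute)
  also have "\<dots> = span (insert u S)" using assms(1) by (rule real_vector.span_redundant)
  finally show ?thesis .
qed

text \<open>Every flat spanned by vectors of \<open>C'\<close> contains at least as many vectors of \<open>C\<close> as of
  \<open>C'\<close>. For hyperplanes this is the hypothesis on functionals; a smaller flat \<open>F\<close> follows by counting
  over the flats of the next dimension through \<open>F\<close>, which partition the vectors outside \<open>F\<close>.\<close>

lemma flat_card_le:
  fixes C C' :: "'i \<Rightarrow> 'a::real_vector"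
  assumes I: "finite I" and c: "c \<le> card I" and C: "krank_ge I c C"
    and supp: "\<And>x :: 'a \<Rightarrow> real. linear x \<Longrightarrow> card {k\<in>I. x (C' k) \<noteq> 0} + c \<le> card I + 1 \<Longrightarrow>
      card {k\<in>I. x (C k) \<noteq> 0} \<le> card {k\<in>I. x (C' k) \<noteq> 0}"
    and L: "L \<subseteq> I"
  shows "card {k\<in>I. C' k \<in> span (C' ` L)} \<le> card {k\<in>I. C k \<in> span (C' ` L)}"
  using L
\<comment> \<open>The induction runs from large flats to small ones: enlarging a flat by a vector of
  \<open>C'\<close> outside it leaves fewer vectors of \<open>C'\<close> outside.\<close>
proof (induction "card {k\<in>I. C' k \<notin> span (C' ` L)}" arbitrary: L rule: less_induct)
  case less
  define F where "F = span (C' ` L)"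
  define N where "N X = card {k\<in>I. C k \<in> X}" for X
  define N' where "N' X = card {k\<in>I. C' k \<in> X}" for X
  define J where "J = {l\<in>I. C' l \<notin> F}"
  define G where "G l = span (insert (C' l) (C' ` L))" for l
  \<comment> \<open>A functional killing every \<open>C' k\<close> has empty support on
    \<open>C'\<close>; since \<open>c \<le> card I\<close>, hypothesis \<open>supp\<close> applies
    and it kills every \<open>C k\<close> as well.\<close>
  have C_in: "C k \<in> span (C' ` I)" if k: "k \<in> I" for k
  proof (rule ccontr)
    assume "C k \<notin> span (C' ` I)"
    from separating_functional[OF this] obtain x :: "'a \<Rightarrow> real"
      where x: "linear x" "\<And>s. s \<in> span (C' ` I) \<Longrightarrow> x s = 0" "x (C k) = 1" by metis
    have "{k\<in>I. x (C' k) \<noteq> 0} = {}" using x(2) by (auto simp: real_vector.span_base)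
    with supp[OF x(1)] c have "card {k\<in>I. x (C k) \<noteq> 0} = 0" by (simp del: Collect_empty_eq)
    then show False using I k x(3) by auto
  qed
  have FG: "F \<subseteq> G l" for l
    unfolding F_def G_def by (intro real_vector.span_mono) auto
  have in_G: "C' l \<in> G l" for l unfolding G_def by (simp add: real_vector.span_base)
  have G_le: "G l \<subseteq> span (C' ` I)" if "l \<in> I" for l
    unfolding G_def using that less.prems by (intro real_vector.span_mono) auto
  have G_eq: "G k = G l" if "C' k \<in> G l" "C' k \<notin> F" for k l
    using that unfolding G_def F_def by (rule span_insert_exchange)
  have IH: "N' (G l) \<le> N (G l)" if l: "l \<in> J" for l
  proof -
    have "{k\<in>I. C' k \<notin> G l} \<subset> {k\<in>I. C' k \<notin> F}"
      using FG[of l] in_G[of l] l unfolding J_def by blast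
    then have "card {k\<in>I. C' k \<notin> G l} < card {k\<in>I. C' k \<notin> F}"
      using I by (intro psubset_card_mono) auto
    then show ?thesis
      using less.hyps[of "insert l L"] less.prems l by (simp add: N_def N'_def G_def F_def J_def)
  qed
  have compl: "card {k\<in>I. P k} + card {k\<in>I. \<not> P k} = card I" for P
    using I by (subst card_Un_disjoint[symmetric]) (auto intro: arg_cong[where f = card])
  have "N' F \<le> N F"
  proof -
    consider "J = {}" | l where "l \<in> J" "G l = span (C' ` I)"
      | l where "l \<in> J" "G l \<noteq> span (C' ` I)" by blast
    then show ?thesis
    proof cases
      case 1
      then have "C' ` I \<subseteq> F" by (auto simp: J_def)
      then have "span (C' ` I) \<subseteq> F"
        unfolding F_def by (metis real_vector.span_minimal real_vector.subspace_span)
      with C_in have "{k\<in>I. C k \<in> F} = I" by auto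
      then show ?thesis unfolding N_def N'_def using I by (auto intro: card_mono)
    next
      case 2
      have l: "l \<in> I" "C' l \<notin> F" using 2 by (auto simp: J_def)
      \<comment> \<open>Here \<open>F\<close> is a hyperplane in the span of \<open>C'\<close>. That
        span contains \<open>c\<close> independent vectors of \<open>C\<close> and is generated by
        \<open>R\<close>, so at least \<open>c - 1\<close> vectors of \<open>C'\<close> lie in
        \<open>F\<close>. This is exactly the smallness condition of \<open>supp\<close>.\<close>
      define R where "R = insert (C' l) (C' ` {k\<in>I. C' k \<in> F})"
      have "c \<le> card R"
      proof (rule ccontr)
        assume "\<not> c \<le> card R"
        moreover obtain K where K: "K \<subseteq> I" "card K = c" using c by (meson obtain_subset_with_card_n)
        moreover have "finite K" using K I finite_subset by blast
        ultimately obtain k where k: "k \<in> K" "C k \<notin> span R"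
          using lin_indep_family_not_in_span[OF krank_geD[OF C], of K R] I by (auto simp: R_def)
        have "C' ` L \<subseteq> C' ` {k\<in>I. C' k \<in> F}"
          using less.prems by (auto simp: F_def real_vector.span_base)
        then have "G l \<subseteq> span R" unfolding G_def R_def by (intro real_vector.span_mono) auto
        with 2 C_in k K show False by auto
      qed
      also have "card R \<le> Suc (N' F)"
        unfolding R_def N'_def
        by (rule order_trans[OF card_insert_le_m1[of "Suc (card {k\<in>I. C' k \<in> F})"]])
          (use I in \<open>auto intro: card_image_le\<close>)
      finally have cN: "c \<le> Suc (N' F)" .
      from separating_functional[of "C' l" "C' ` L"] l(2) obtain x :: "'a \<Rightarrow> real"
        where x: "linear x" "\<And>s. s \<in> F \<Longrightarrow> x s = 0" "x (C' l) = 1" unfolding F_def by metis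
      \<comment> \<open>Within the span the kernel of \<open>x\<close> is exactly \<open>F\<close>,
        so the two supports in \<open>supp\<close> count the vectors outside
        \<open>F\<close>.\<close>
      have iff: "x v \<noteq> 0 \<longleftrightarrow> v \<notin> F" if v: "v \<in> span (C' ` I)" for v
      proof
        assume "v \<notin> F"
        have "v \<in> span (insert (C' l) (C' ` L))" using v 2 by (simp add: G_def)
        then obtain r where r: "v - r *\<^sub>R C' l \<in> F"
          unfolding real_vector.span_breakdown_eq F_def by blast
        with x have "x v = r" by (metis diff_eq_eq linear_diff linear_scale mult.right_neutral
          add.left_neutral real_scaleR_def)
        with r \<open>v \<notin> F\<close> show "x v \<noteq> 0" by auto
      qed (use x(2) in auto)
      have "{k\<in>I. x (C k) \<noteq> 0} = {k\<in>I. C k \<notin> F}" using iff C_in by auto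
      moreover have "{k\<in>I. x (C' k) \<noteq> 0} = {k\<in>I. C' k \<notin> F}"
        using iff by (auto simp: real_vector.span_base)
      ultimately have "card {k\<in>I. C k \<notin> F} \<le> card {k\<in>I. C' k \<notin> F}"
        using supp[OF x(1)] cN compl[of "\<lambda>k. C' k \<in> F"] by (simp add: N'_def)
      then show ?thesis
        using compl[of "\<lambda>k. C k \<in> F"] compl[of "\<lambda>k. C' k \<in> F"] unfolding N_def N'_def by linarith
    next
      case 3
      have "\<not> C' ` I \<subseteq> G l"
      proof
        assume "C' ` I \<subseteq> G l"
        then have "span (C' ` I) \<subseteq> G l"
          unfolding G_def by (metis real_vector.span_minimal real_vector.subspace_span)
        with 3 G_le[of l] show False by (auto simp: J_def)
      qed
      \<comment> \<open>Now \<open>F\<close> has codimension at least two, so at least two flats of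
        the next dimension pass through it. The final contradiction depends on this.\<close>
      then obtain l' where l': "l' \<in> I" "C' l' \<notin> G l" by auto
      then have l'J: "l' \<in> J" using FG[of l] by (auto simp: J_def)
      have finJ: "finite J" using I by (simp add: J_def)
      have "card {G l, G l'} \<le> card (G ` J)"
        using 3 l'J finJ by (intro card_mono) auto
      moreover have "G l \<noteq> G l'" using l' in_G[of l'] by auto
      ultimately have two: "2 \<le> card (G ` J)" by simp
      \<comment> \<open>By exchange, a flat \<open>G l\<close> is generated over \<open>F\<close> by
        any of its vectors outside \<open>F\<close>, so distinct flats meet only in
        \<open>F\<close>.\<close>
      have meet: "X = Y" if "X \<in> G ` J" "Y \<in> G ` J" "v \<in> X" "v \<in> Y" "v \<notin> F" for X Y v
      proof -
        have "X = span (insert v (C' ` L))" "Y = span (insert v (C' ` L))"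
          using that span_insert_exchange[of v _ "C' ` L"] unfolding G_def F_def by auto
        then show ?thesis by simp
      qed
      have disj: "\<forall>X\<in>G ` J. \<forall>Y\<in>G ` J. X \<noteq> Y \<longrightarrow>
          {k\<in>I. D k \<in> X - F} \<inter> {k\<in>I. D k \<in> Y - F} = {}" for D :: "'i \<Rightarrow> 'a"
        using meet by blast
      have "card J = card (\<Union>X\<in>G ` J. {k\<in>I. C' k \<in> X - F})"
        using in_G G_le by (intro arg_cong[where f = card]) (auto simp: J_def)
      also have "\<dots> = (\<Sum>X\<in>G ` J. card {k\<in>I. C' k \<in> X - F})"
        using finJ I by (intro card_UN_disjoint disj) auto
      finally have J_sum: "card J = (\<Sum>X\<in>G ` J. card {k\<in>I. C' k \<in> X - F})" .
      have "(\<Sum>X\<in>G ` J. card {k\<in>I. C k \<in> X - F}) = card (\<Union>X\<in>G ` J. {k\<in>I. C k \<in> X - F})"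
        using finJ I by (intro card_UN_disjoint[symmetric] disj) auto
      also have "\<dots> \<le> card {k\<in>I. C k \<notin> F}" using I by (intro card_mono) auto
      finally have C_sum: "(\<Sum>X\<in>G ` J. card {k\<in>I. C k \<in> X - F}) \<le> card {k\<in>I. C k \<notin> F}" .
      have split: "card {k\<in>I. D k \<in> X} = card {k\<in>I. D k \<in> F} + card {k\<in>I. D k \<in> X - F}"
        if "X \<in> G ` J" for X and D :: "'i \<Rightarrow> 'a"
        using I FG that
        by (subst card_Un_disjoint[symmetric]) (auto intro!: arg_cong[where f = card])
      show ?thesis
      proof (rule ccontr)
        assume neg: "\<not> N' F \<le> N F"
        \<comment> \<open>If \<open>F\<close> had an excess \<open>\<delta>\<close> of vectors of
          \<open>C'\<close>, the induction hypothesis would force every larger flat to compensate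
          with \<open>\<delta>\<close> extra vectors of \<open>C\<close> outside \<open>F\<close>.
          Only \<open>card J + \<delta>\<close> vectors of \<open>C\<close> lie outside
          \<open>F\<close>, while the at least two flats would demand
          \<open>card J + 2 * \<delta>\<close>.\<close>
        define \<delta> where "\<delta> = N' F - N F"
        have "card J + card (G ` J) * \<delta> = (\<Sum>X\<in>G ` J. card {k\<in>I. C' k \<in> X - F} + \<delta>)"
          by (simp add: J_sum sum.distrib)
        also have "\<dots> \<le> (\<Sum>X\<in>G ` J. card {k\<in>I. C k \<in> X - F})"
        proof (rule sum_mono)
          fix X assume X: "X \<in> G ` J"
          then have "N' X \<le> N X" using IH by auto
          then show "card {k\<in>I. C' k \<in> X - F} + \<delta> \<le> card {k\<in>I. C k \<in> X - F}"
            using split[OF X, of C] split[OF X, of C'] neg unfolding N_def N'_def \<delta>_def by linarith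
        qed
        also note C_sum
        finally have "card J + card (G ` J) * \<delta> + N F \<le> card I"
          using compl[of "\<lambda>k. C k \<in> F"] by (simp add: N_def)
        moreover have "card J + N' F = card I"
          using compl[of "\<lambda>k. C' k \<in> F"] by (simp add: N'_def J_def)
        moreover have "2 * \<delta> \<le> card (G ` J) * \<delta>" using two by (rule mult_right_mono) simp
        ultimately show False using neg unfolding \<delta>_def by linarith
      qed
    qed
  qed
  then show ?case by (simp add: N_def N'_def F_def)
qed

lemma krank_ge_2_unique_in_line:
  fixes A :: "'i \<Rightarrow> 'a::real_vector"
  assumes A: "krank_ge I n A" "2 \<le> n" and kl: "k \<in> I" "l \<in> I"
    and v: "A k \<in> span {v}" "A l \<in> span {v}"
  shows "k = l"
proof (rule ccontr)
  assume "k \<noteq> l"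
  then have "lin_indep_family {k, l} A" using A kl by (intro krank_geD[OF A(1)]) auto
  from lin_indep_family_not_in_span[OF this, of "{v}"] \<open>k \<noteq> l\<close> v show False by auto
qed

lemma span_singleton_eq:
  fixes u v :: "'a::real_vector"
  assumes "u \<in> span {v}" "u \<noteq> 0"
  shows "span {u} = span {v}"
  using span_insert_exchange[of u v "{}"] assms by simp

text \<open>Applying the flat bound to the line through \<open>C' k\<close> yields some
  \<open>C l\<close> on that line. If two indices chose the same \<open>l\<close>, their lines would
  coincide and contain two vectors of \<open>C'\<close>, hence two of \<open>C\<close>, which
  Kruskal rank 2 forbids.\<close>

lemma kruskal_permutation:
  fixes C C' :: "'i \<Rightarrow> 'a::real_vector"
  assumes I: "finite I" and c: "2 \<le> c" "c \<le> card I" and C: "krank_ge I c C"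
    and supp: "\<And>x :: 'a \<Rightarrow> real. linear x \<Longrightarrow> card {k\<in>I. x (C' k) \<noteq> 0} + c \<le> card I + 1 \<Longrightarrow>
      card {k\<in>I. x (C k) \<noteq> 0} \<le> card {k\<in>I. x (C' k) \<noteq> 0}"
  obtains \<sigma> where "\<sigma> permutes I" "\<And>k. k \<in> I \<Longrightarrow> C (\<sigma> k) \<in> span {C' k}"
proof -
  note flat = flat_card_le[OF I c(2) C supp]
  have "\<exists>l\<in>I. C l \<in> span {C' k}" if k: "k \<in> I" for k
  proof -
    have "0 < card {l\<in>I. C' l \<in> span {C' k}}"
      using I k by (auto simp: card_gt_0_iff real_vector.span_base)
    also have "\<dots> \<le> card {l\<in>I. C l \<in> span {C' k}}" using flat[of "{k}"] k by simp
    finally show ?thesis by (auto simp: card_gt_0_iff)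
  qed
  then obtain s where s: "\<And>k. k \<in> I \<Longrightarrow> s k \<in> I \<and> C (s k) \<in> span {C' k}" by metis
  have "inj_on s I"
  proof (rule inj_onI, rule ccontr)
    fix k l assume kl: "k \<in> I" "l \<in> I" "s k = s l" "k \<noteq> l"
    have nz: "C (s k) \<noteq> 0" using krank_ge_nonzero[OF C] c s kl by simp
    have "span {C (s k)} = span {C' k}"
      using nz s[OF kl(1)] by (intro span_singleton_eq) simp_all
    moreover have "span {C (s k)} = span {C' l}"
      using nz s[OF kl(2)] kl(3) by (intro span_singleton_eq) simp_all
    ultimately have "C' k \<in> span {C' k}" "C' l \<in> span {C' k}"
      by (metis insertI1 real_vector.span_base)+
    then have "card {k, l} \<le> card {i\<in>I. C' i \<in> span {C' k}}"
      using kl(1,2) I by (intro card_mono) auto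
    also have "\<dots> \<le> card {i\<in>I. C i \<in> span {C' k}}" using flat[of "{k}"] kl by simp
    also have "\<dots> \<le> card {s k}"
      using krank_ge_2_unique_in_line[OF C c(1)] s[OF kl(1)] by (intro card_mono) auto
    finally show False using kl by simp
  qed
  moreover have "s ` I \<subseteq> I" using s by auto
  ultimately have "bij_betw s I I" using endo_inj_surj[OF I] by (simp add: bij_betw_def)
  then have "bij_betw (\<lambda>k. if k \<in> I then s k else k) I I"
    by (subst bij_betw_cong[where g = s]) auto
  then have "(\<lambda>k. if k \<in> I then s k else k) permutes I" by (rule bij_imp_permutes) simp
  then show ?thesis using that s by simp
qed

section \<open>Uniqueness of decompositions into rank-one tensors of order three\<close>

text \<open>Equality of \<open>\<Sum>\<^sub>k w\<^sub>k A\<^sub>k \<otimes> B\<^sub>k \<otimes> C\<^sub>k\<close> and \<open>\<Sum>\<^sub>k w'\<^sub>k A'\<^sub>k \<otimes> B'\<^sub>k \<otimes> C'\<^sub>k\<close>, tested on the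
  functionals \<open>f \<otimes> g \<otimes> h\<close>, which separate the points of the algebraic tensor product.\<close>

definition tensor_eq ::
  "'i set \<Rightarrow> ('i \<Rightarrow> real) \<Rightarrow> ('i \<Rightarrow> 'a::real_vector) \<Rightarrow> ('i \<Rightarrow> 'b::real_vector) \<Rightarrow> ('i \<Rightarrow> 'c::real_vector) \<Rightarrow>
    ('i \<Rightarrow> real) \<Rightarrow> ('i \<Rightarrow> 'a) \<Rightarrow> ('i \<Rightarrow> 'b) \<Rightarrow> ('i \<Rightarrow> 'c) \<Rightarrow> bool" where
  "tensor_eq I w A B C w' A' B' C' \<longleftrightarrow>
    (\<forall>f g h. linear f \<longrightarrow> linear g \<longrightarrow> linear h \<longrightarrow>
      (\<Sum>k\<in>I. w k * f (A k) * g (B k) * h (C k)) = (\<Sum>k\<in>I. w' k * f (A' k) * g (B' k) * h (C' k)))"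

lemma tensor_eq_swap23:
  assumes "tensor_eq I w A B C w' A' B' C'"
  shows "tensor_eq I w A C B w' A' C' B'"
  unfolding tensor_eq_def
proof (intro allI impI)
  fix f :: "'b \<Rightarrow> real" and g :: "'d \<Rightarrow> real" and h :: "'c \<Rightarrow> real"
  assume "linear f" "linear g" "linear h"
  with assms have "(\<Sum>k\<in>I. w k * f (A k) * h (B k) * g (C k)) = (\<Sum>k\<in>I. w' k * f (A' k) * h (B' k) * g (C' k))"
    by (simp add: tensor_eq_def)
  then show "(\<Sum>k\<in>I. w k * f (A k) * g (C k) * h (B k)) = (\<Sum>k\<in>I. w' k * f (A' k) * g (C' k) * h (B' k))"
    by (simp add: mult_ac)
qed

lemma tensor_eq_swap12:
  assumes "tensor_eq I w A B C w' A' B' C'"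
  shows "tensor_eq I w B A C w' B' A' C'"
  unfolding tensor_eq_def
proof (intro allI impI)
  fix f :: "'c \<Rightarrow> real" and g :: "'b \<Rightarrow> real" and h :: "'d \<Rightarrow> real"
  assume "linear f" "linear g" "linear h"
  with assms have "(\<Sum>k\<in>I. w k * g (A k) * f (B k) * h (C k)) = (\<Sum>k\<in>I. w' k * g (A' k) * f (B' k) * h (C' k))"
    by (simp add: tensor_eq_def)
  then show "(\<Sum>k\<in>I. w k * f (B k) * g (A k) * h (C k)) = (\<Sum>k\<in>I. w' k * f (B' k) * g (A' k) * h (C' k))"
    by (simp add: mult_ac)
qed

lemma tensor_eq_slice:
  fixes h :: "'c::real_vector \<Rightarrow> real"
  assumes "tensor_eq I w A B C w' A' B' C'" "finite I" "linear f" "linear g" "linear h"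
  shows "(\<Sum>k\<in>{k\<in>I. h (C k) \<noteq> 0}. (w k * h (C k)) * f (A k) * g (B k)) =
    (\<Sum>k\<in>{k\<in>I. h (C' k) \<noteq> 0}. (w' k * h (C' k)) * f (A' k) * g (B' k))"
proof -
  have "(\<Sum>k\<in>{k\<in>I. h (C k) \<noteq> 0}. (w k * h (C k)) * f (A k) * g (B k)) =
      (\<Sum>k\<in>I. w k * f (A k) * g (B k) * h (C k))"
    using assms(2) by (intro sum.mono_neutral_cong_left) auto
  also have "\<dots> = (\<Sum>k\<in>I. w' k * f (A' k) * g (B' k) * h (C' k))"
    using assms by (simp add: tensor_eq_def)
  also have "\<dots> = (\<Sum>k\<in>{k\<in>I. h (C' k) \<noteq> 0}. (w' k * h (C' k)) * f (A' k) * g (B' k))"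
    using assms(2) by (intro sum.mono_neutral_cong_right) auto
  finally show ?thesis .
qed

text \<open>Contracting the third factor with \<open>x\<close> leaves an identity between sums with
  \<open>s\<close> and \<open>s'\<close> nonzero terms, to which the rank bound applies. This
  supplies the support hypothesis of the permutation lemma.\<close>

lemma tensor_eq_permutation:
  fixes C C' :: "'i \<Rightarrow> 'c::real_vector"
  assumes eq: "tensor_eq I w A B C w' A' B' C'" and I: "finite I"
    and w: "\<And>k. k \<in> I \<Longrightarrow> w k \<noteq> 0"
    and A: "krank_ge I a A" and B: "krank_ge I b B" and C: "krank_ge I c C"
    and le: "a \<le> card I" "b \<le> card I" "c \<le> card I"
    and sum: "2 * card I + 2 \<le> a + b + c"
  obtains \<sigma> where "\<sigma> permutes I" "\<And>k. k \<in> I \<Longrightarrow> C (\<sigma> k) \<in> span {C' k}"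
proof (rule kruskal_permutation[OF I _ le(3) C])
  show "2 \<le> c" using le sum by linarith
next
  fix x :: "'c \<Rightarrow> real"
  assume x: "linear x" and small: "card {k\<in>I. x (C' k) \<noteq> 0} + c \<le> card I + 1"
  define s where "s = card {k\<in>I. x (C k) \<noteq> 0}"
  define s' where "s' = card {k\<in>I. x (C' k) \<noteq> 0}"
  have "min a s + min b s \<le> s + s'"
    unfolding s_def s'_def
  proof (rule tensor_rank_bound[where A = A and B = B and A' = A' and B' = B'])
    show "krank_ge {k \<in> I. x (C k) \<noteq> 0} a A" using A by (rule krank_ge_subset) auto
    show "krank_ge {k \<in> I. x (C k) \<noteq> 0} b B" using B by (rule krank_ge_subset) auto
    show "w k * x (C k) \<noteq> 0" if "k \<in> {k \<in> I. x (C k) \<noteq> 0}" for k using that w by auto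
  qed (use I tensor_eq_slice[OF eq I _ _ x] in auto)
  moreover have "s \<le> card I" unfolding s_def using I by (intro card_mono) auto
  \<comment> \<open>Smallness and \<open>sum\<close> give
    \<open>s' + card I + 1 \<le> a + b\<close>. If \<open>s\<close> exceeded \<open>a\<close> or
    \<open>b\<close>, this would contradict the rank bound; otherwise the bound reads
    \<open>2 * s \<le> s + s'\<close>.\<close>
  ultimately have "s \<le> s'" using small le sum unfolding s'_def[symmetric] by linarith
  then show "card {k\<in>I. x (C k) \<noteq> 0} \<le> card {k\<in>I. x (C' k) \<noteq> 0}" by (simp add: s_def s'_def)
qed (use that in auto)

text \<open>If the permutations differed at \<open>i\<close>, a functional \<open>x\<close> on the
  third factor could suppress the term \<open>\<alpha> i\<close> on the left while keeping
  \<open>i\<close> on the right. A functional \<open>f\<close> killing the remaining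
  \<open>A k\<close> but not \<open>A (\<alpha> i)\<close> then annihilates the left slice, and
  independence of \<open>B\<close> forces \<open>f (A' i) = 0\<close>.\<close>

lemma tensor_eq_permutations_agree:
  fixes A A' :: "'i \<Rightarrow> 'a::real_vector" and B B' :: "'i \<Rightarrow> 'b::real_vector"
    and C C' :: "'i \<Rightarrow> 'c::real_vector"
  assumes eq: "tensor_eq I w A B C w' A' B' C'" and I: "finite I"
    and w': "\<And>k. k \<in> I \<Longrightarrow> w' k \<noteq> 0"
    and A: "krank_ge I a A" and B: "krank_ge I b B" and C: "krank_ge I c C"
    and c: "2 \<le> c" "c \<le> card I" and ac: "card I + 2 \<le> a + c" and bc: "card I + 1 \<le> b + c"
    and b: "1 \<le> b"
    and \<alpha>: "\<alpha> permutes I" "\<And>k. k \<in> I \<Longrightarrow> A (\<alpha> k) \<in> span {A' k}"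
    and \<beta>: "\<beta> permutes I" "\<And>k. k \<in> I \<Longrightarrow> B (\<beta> k) \<in> span {B' k}"
    and \<gamma>: "\<gamma> permutes I" "\<And>k. k \<in> I \<Longrightarrow> C (\<gamma> k) \<in> span {C' k}"
    and i: "i \<in> I"
  shows "\<alpha> i = \<gamma> i"
proof (rule ccontr)
  assume neq: "\<alpha> i \<noteq> \<gamma> i"
  have in_I: "\<alpha> k \<in> I" "\<beta> k \<in> I" "\<gamma> k \<in> I" if "k \<in> I" for k
    using that \<alpha>(1) \<beta>(1) \<gamma>(1) by (auto simp: permutes_in_image)
  have "card (I - {\<alpha> i, \<gamma> i}) = card I - 2"
    using I in_I[OF i] neq by (simp add: card_Diff_subset)
  \<comment> \<open>\<open>Z\<close> will have \<open>c - 1\<close> elements, including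
    \<open>\<alpha> i\<close>. Adding \<open>\<gamma> i\<close> uses up the whole Kruskal rank of
    \<open>C\<close> and makes the support of \<open>x\<close> as small as this method
    permits.\<close>
  then obtain Z0 where Z0: "Z0 \<subseteq> I - {\<alpha> i, \<gamma> i}" "card Z0 = c - 2"
    by (metis c(2) diff_le_mono obtain_subset_with_card_n)
  define Z where "Z = insert (\<alpha> i) Z0"
  have finZ: "finite Z" "finite Z0" using Z0 I finite_subset[of Z0 I] by (auto simp: Z_def)
  have Z: "Z \<subseteq> I" "card Z = c - 1" "\<gamma> i \<notin> Z" "\<alpha> i \<in> Z"
    using Z0 finZ c in_I[OF i] neq by (auto simp: Z_def card_insert_if)
  have "lin_indep_family (insert (\<gamma> i) Z) C"
    using Z finZ c in_I[OF i] by (intro krank_geD[OF C]) auto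
  from dual_functional[OF this finZ(1) Z(3)] obtain x :: "'c \<Rightarrow> real"
    where x: "linear x" "\<And>k. k \<in> Z \<Longrightarrow> x (C k) = 0" "x (C (\<gamma> i)) = 1" by metis
  define K where "K = {k\<in>I. x (C k) \<noteq> 0}"
  define K' where "K' = {k\<in>I. x (C' k) \<noteq> 0}"
  have finK: "finite K" "finite K'" using I by (auto simp: K_def K'_def)
  have "K \<subseteq> I - Z" using x(2) by (auto simp: K_def)
  then have "card K \<le> card I - (c - 1)"
    using card_mono[of "I - Z" K] I Z finZ by (simp add: card_Diff_subset)
  \<comment> \<open>The spare unit in the bound for \<open>a\<close> leaves room to add
    \<open>\<alpha> i\<close> to \<open>K\<close> and keep \<open>A\<close> independent.\<close>
  then have cardK: "card K + 1 \<le> a" "card K \<le> b" using ac bc c by linarith+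
  have \<gamma>_iff: "x (C' k) \<noteq> 0 \<longleftrightarrow> x (C (\<gamma> k)) \<noteq> 0" if k: "k \<in> I" for k
  proof -
    have "C (\<gamma> k) \<noteq> 0" using krank_ge_nonzero[OF C] c in_I[OF k] by simp
    moreover obtain s where "C (\<gamma> k) = s *\<^sub>R C' k"
      using \<gamma>(2)[OF k] by (auto simp: real_vector.span_singleton)
    ultimately show ?thesis by (simp add: linear_scale[OF x(1)])
  qed
  have "\<gamma> ` K' \<subseteq> K" using \<gamma>_iff in_I by (auto simp: K_def K'_def)
  then have "card K' \<le> card K"
    using card_mono[OF finK(1)] card_image[of \<gamma> K'] permutes_inj_on[OF \<gamma>(1)] by metis
  then have cardK': "card K' \<le> b" using cardK by simp
  have "\<alpha> i \<notin> K" using x(2) Z(4) by (auto simp: K_def)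
  moreover have "lin_indep_family (insert (\<alpha> i) K) A"
    using cardK in_I[OF i] finK \<open>\<alpha> i \<notin> K\<close> by (intro krank_geD[OF A]) (auto simp: K_def)
  ultimately obtain f :: "'a \<Rightarrow> real"
    where f: "linear f" "\<And>k. k \<in> K \<Longrightarrow> f (A k) = 0" "f (A (\<alpha> i)) = 1"
    using dual_functional finK by metis
  have "\<exists>t. B' k = t *\<^sub>R B (\<beta> k) \<and> t \<noteq> 0" if k: "k \<in> I" for k
  proof -
    have "B (\<beta> k) \<noteq> 0" using krank_ge_nonzero[OF B b] in_I[OF k] by simp
    moreover obtain s where "B (\<beta> k) = s *\<^sub>R B' k"
      using \<beta>(2)[OF k] by (auto simp: real_vector.span_singleton)
    ultimately show ?thesis by (intro exI[of _ "inverse s"]) auto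
  qed
  then obtain t where t: "\<And>k. k \<in> I \<Longrightarrow> B' k = t k *\<^sub>R B (\<beta> k) \<and> t k \<noteq> 0" by metis
  have K'I: "K' \<subseteq> I" by (auto simp: K'_def)
  have inj: "inj_on \<beta> K'" by (rule permutes_inj_on[OF \<beta>(1)])
  \<comment> \<open>These are the coefficients of the contracted right-hand side once each
    \<open>B' k\<close> is rewritten as a multiple of \<open>B (\<beta> k)\<close>, so that the
    independence of \<open>B\<close> applies.\<close>
  define e where "e k = w' k * x (C' k) * f (A' k) * t k" for k
  have inv: "inv \<beta> (\<beta> k) = k" for k using permutes_inverses(2)[OF \<beta>(1)] by simp
  have "(\<Sum>k\<in>\<beta> ` K'. e (inv \<beta> k) *\<^sub>R B k) = 0"
  proof (rule eq_0_if_functionals_0)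
    fix g :: "'b \<Rightarrow> real" assume g: "linear g"
    have "(\<Sum>k\<in>\<beta> ` K'. e (inv \<beta> k) *\<^sub>R B k) = (\<Sum>k\<in>K'. e k *\<^sub>R B (\<beta> k))"
      by (simp add: sum.reindex[OF inj] inv)
    then have "g (\<Sum>k\<in>\<beta> ` K'. e (inv \<beta> k) *\<^sub>R B k) = (\<Sum>k\<in>K'. e k * g (B (\<beta> k)))"
      by (simp add: linear_sum[OF g] linear_scale[OF g])
    also have "\<dots> = (\<Sum>k\<in>K'. (w' k * x (C' k)) * f (A' k) * g (B' k))"
      using t K'I by (intro sum.cong) (auto simp: e_def linear_scale[OF g] subset_iff)
    also have "\<dots> = (\<Sum>k\<in>K. (w k * x (C k)) * f (A k) * g (B k))"
      using tensor_eq_slice[OF eq I f(1) g x(1)] by (simp add: K_def K'_def)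
    also have "\<dots> = 0" using f(2) by simp
    finally show "g (\<Sum>k\<in>\<beta> ` K'. e (inv \<beta> k) *\<^sub>R B k) = 0" .
  qed
  moreover have "lin_indep_family (\<beta> ` K') B"
    using in_I K'I cardK' finK card_image[OF inj] by (intro krank_geD[OF B]) auto
  ultimately have "\<forall>k\<in>\<beta> ` K'. e (inv \<beta> k) = 0" by (rule lin_indep_familyD[rotated])
  then have "\<forall>k\<in>K'. e k = 0" by (simp add: inv)
  moreover have "i \<in> K'" using i x(3) \<gamma>_iff by (simp add: K'_def)
  ultimately have "e i = 0" by blast
  then have "f (A' i) = 0" using w' i t \<open>i \<in> K'\<close> by (auto simp: e_def K'_def)
  moreover obtain s where "A (\<alpha> i) = s *\<^sub>R A' i"
    using \<alpha>(2)[OF i] by (auto simp: real_vector.span_singleton)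
  ultimately show False using f(3) by (simp add: linear_scale[OF f(1)])
qed

text \<open>The competing families \<open>A'\<close>, \<open>B'\<close>, \<open>C'\<close> are
  arbitrary; rank conditions concern the left side only. The permutation found for the third factor
  serves for all three.\<close>

theorem kruskal:
  fixes A A' :: "'i \<Rightarrow> 'a::real_vector" and B B' :: "'i \<Rightarrow> 'b::real_vector"
    and C C' :: "'i \<Rightarrow> 'c::real_vector"
  assumes eq: "tensor_eq I w A B C w' A' B' C'" and I: "finite I"
    and w: "\<And>k. k \<in> I \<Longrightarrow> w k \<noteq> 0" and w': "\<And>k. k \<in> I \<Longrightarrow> w' k \<noteq> 0"
    and A: "krank_ge I a A" and B: "krank_ge I b B" and C: "krank_ge I c C"
    and le: "a \<le> card I" "b \<le> card I" "c \<le> card I"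
    and sum: "2 * card I + 2 \<le> a + b + c"
  obtains \<sigma> where "\<sigma> permutes I"
    "\<And>k. k \<in> I \<Longrightarrow> A (\<sigma> k) \<in> span {A' k} \<and> B (\<sigma> k) \<in> span {B' k} \<and> C (\<sigma> k) \<in> span {C' k}"
proof -
  have eqB: "tensor_eq I w A C B w' A' C' B'" using eq by (rule tensor_eq_swap23)
  have eqA: "tensor_eq I w C B A w' C' B' A'"
    by (rule tensor_eq_swap12, rule tensor_eq_swap23, rule tensor_eq_swap12, rule eq)
  obtain \<alpha> where \<alpha>: "\<alpha> permutes I" "\<And>k. k \<in> I \<Longrightarrow> A (\<alpha> k) \<in> span {A' k}"
    using tensor_eq_permutation[OF eqA I w C B A] le sum by auto
  obtain \<beta> where \<beta>: "\<beta> permutes I" "\<And>k. k \<in> I \<Longrightarrow> B (\<beta> k) \<in> span {B' k}"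
    using tensor_eq_permutation[OF eqB I w A C B] le sum by auto
  obtain \<gamma> where \<gamma>: "\<gamma> permutes I" "\<And>k. k \<in> I \<Longrightarrow> C (\<gamma> k) \<in> span {C' k}"
    using tensor_eq_permutation[OF eq I w A B C] le sum by auto
  \<comment> \<open>As each rank is at most \<open>card I\<close>, each is at least 2 and any two
    add up to at least \<open>card I + 2\<close>.\<close>
  have "\<alpha> k = \<gamma> k" if "k \<in> I" for k
    by (rule tensor_eq_permutations_agree[OF eq I w' A B C _ _ _ _ _ \<alpha> \<beta> \<gamma> that])
      (use le sum in linarith)+
  moreover have "\<beta> k = \<gamma> k" if "k \<in> I" for k
    by (rule tensor_eq_permutations_agree[OF tensor_eq_swap12[OF eq] I w' B A C _ _ _ _ _ \<beta> \<alpha> \<gamma> that])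
      (use le sum in linarith)+
  ultimately show ?thesis using that[OF \<gamma>(1)] \<alpha>(2) \<beta>(2) \<gamma>(2) by metis
qed

text \<open>Subtracting the sides and contracting with \<open>h\<close> gives a vanishing bilinear
  sum with coefficients \<open>p\<close>. The rank bound with an empty right side rules out a
  nonempty support, yet \<open>p i\<close> is nonzero when the weights at \<open>i\<close>
  differ.\<close>

lemma tensor_eq_weights_unique:
  fixes A :: "'i \<Rightarrow> 'a::real_vector" and B :: "'i \<Rightarrow> 'b::real_vector" and C :: "'i \<Rightarrow> 'c::real_vector"
  assumes eq: "tensor_eq I w A B C w' A B C" and I: "finite I"
    and A: "krank_ge I a A" and B: "krank_ge I b B" and C: "krank_ge I c C"
    and pos: "1 \<le> a" "1 \<le> b" "1 \<le> c" and sum: "card I + 1 \<le> a + b"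
    and i: "i \<in> I"
  shows "w i = w' i"
proof (rule ccontr)
  assume neq: "w i \<noteq> w' i"
  have "lin_indep_family (insert i {}) C" using i pos by (intro krank_geD[OF C]) auto
  then obtain h :: "'c \<Rightarrow> real" where h: "linear h" "h (C i) = 1"
    by (rule dual_functional[of i "{}" C]) auto
  define p where "p k = (w k - w' k) * h (C k)" for k
  define K where "K = {k\<in>I. p k \<noteq> 0}"
  have "min a (card K) + min b (card K) \<le> card K + card ({} :: 'i set)"
  proof (rule tensor_rank_bound[where A = A and B = B])
    show "krank_ge K a A" using A by (rule krank_ge_subset) (auto simp: K_def)
    show "krank_ge K b B" using B by (rule krank_ge_subset) (auto simp: K_def)
    fix f :: "'a \<Rightarrow> real" and g :: "'b \<Rightarrow> real" assume fg: "linear f" "linear g"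
    have "(\<Sum>k\<in>K. p k * f (A k) * g (B k)) = (\<Sum>k\<in>I. p k * f (A k) * g (B k))"
      using I by (intro sum.mono_neutral_left) (auto simp: K_def)
    also have "\<dots> = (\<Sum>k\<in>I. w k * f (A k) * g (B k) * h (C k)) - (\<Sum>k\<in>I. w' k * f (A k) * g (B k) * h (C k))"
      by (simp add: p_def sum_subtractf[symmetric] algebra_simps)
    also have "\<dots> = 0" using eq fg h(1) by (simp add: tensor_eq_def)
    finally show "(\<Sum>k\<in>K. p k * f (A k) * g (B k)) = (\<Sum>k\<in>{}. p k * f (A k) * g (B k))" by simp
  qed (use I in \<open>auto simp: K_def\<close>)
  moreover have "card K \<le> card I" using I by (intro card_mono) (auto simp: K_def)
  moreover have "0 < card K" using I i h(2) neq by (auto simp: K_def p_def card_gt_0_iff)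
  ultimately show False using pos sum by auto
qed

lemma tensor_eq_permute_right:
  fixes A A' :: "'i \<Rightarrow> 'a::real_vector" and B B' :: "'i \<Rightarrow> 'b::real_vector"
    and C C' :: "'i \<Rightarrow> 'c::real_vector"
  assumes eq: "tensor_eq I w A B C w' A' B' C'" and \<sigma>: "\<sigma> permutes I"
    and eqs: "\<And>k. k \<in> I \<Longrightarrow> A (\<sigma> k) = A' k \<and> B (\<sigma> k) = B' k \<and> C (\<sigma> k) = C' k"
  shows "tensor_eq I w A B C (\<lambda>k. w' (inv \<sigma> k)) A B C"
  unfolding tensor_eq_def
proof (intro allI impI)
  fix f :: "'a \<Rightarrow> real" and g :: "'b \<Rightarrow> real" and h :: "'c \<Rightarrow> real"
  assume fgh: "linear f" "linear g" "linear h"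
  have "(\<Sum>k\<in>I. w' (inv \<sigma> k) * f (A k) * g (B k) * h (C k)) =
      (\<Sum>k\<in>I. w' (inv \<sigma> (\<sigma> k)) * f (A (\<sigma> k)) * g (B (\<sigma> k)) * h (C (\<sigma> k)))"
    using sum.permute[OF \<sigma>, of "\<lambda>k. w' (inv \<sigma> k) * f (A k) * g (B k) * h (C k)"]
    by (simp add: o_def)
  also have "\<dots> = (\<Sum>k\<in>I. w' k * f (A' k) * g (B' k) * h (C' k))"
    using eqs permutes_inverses(2)[OF \<sigma>] by (intro sum.cong) auto
  finally show "(\<Sum>k\<in>I. w k * f (A k) * g (B k) * h (C k)) =
      (\<Sum>k\<in>I. w' (inv \<sigma> k) * f (A k) * g (B k) * h (C k))"
    using eq fgh by (simp add: tensor_eq_def)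
qed

section \<open>Tensor products of real functions\<close>

instantiation "fun" :: (type, real_vector) real_vector
begin

definition scaleR_fun_def: "c *\<^sub>R f = (\<lambda>x. c *\<^sub>R f x)"

instance
  by standard (simp_all add: scaleR_fun_def fun_eq_iff scaleR_add_right scaleR_add_left)

end

lemma sum_fun_apply: "(\<Sum>i\<in>I. F i) x = (\<Sum>i\<in>I. F i x)"
  by (induction I rule: infinite_finite_induct) auto

text \<open>A pointwise identity is an equality of vectors in the function space, so any linear
  functional may be applied, not only evaluation. Repeating this in one argument at a time turns
  identities on boxes into \<open>tensor_eq\<close>.\<close>

lemma sum_functional_eq:
  fixes A A' :: "'i \<Rightarrow> 'x \<Rightarrow> real"
  assumes "\<And>x. (\<Sum>k\<in>I. c k * A k x) = (\<Sum>k\<in>J. c' k * A' k x)" and f: "linear f"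
  shows "(\<Sum>k\<in>I. c k * f (A k)) = (\<Sum>k\<in>J. c' k * f (A' k))"
proof -
  have "(\<Sum>k\<in>I. c k *\<^sub>R A k) = (\<Sum>k\<in>J. c' k *\<^sub>R A' k)"
    by (rule ext) (use assms in \<open>simp add: sum_fun_apply scaleR_fun_def\<close>)
  then have "f (\<Sum>k\<in>I. c k *\<^sub>R A k) = f (\<Sum>k\<in>J. c' k *\<^sub>R A' k)" by simp
  then show ?thesis by (simp add: linear_sum[OF f] linear_scale[OF f])
qed

lemma bilinear_eq_if_pointwise:
  fixes A A' :: "'i \<Rightarrow> 'x \<Rightarrow> real" and B B' :: "'i \<Rightarrow> 'y \<Rightarrow> real"
  assumes eq: "\<And>x y. (\<Sum>k\<in>I. w k * A k x * B k y) = (\<Sum>k\<in>J. w' k * A' k x * B' k y)"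
    and f: "linear f" and g: "linear g"
  shows "(\<Sum>k\<in>I. w k * f (A k) * g (B k)) = (\<Sum>k\<in>J. w' k * f (A' k) * g (B' k))"
proof -
  have "(\<Sum>k\<in>I. w k * A k x * g (B k)) = (\<Sum>k\<in>J. w' k * A' k x * g (B' k))" for x
    by (rule sum_functional_eq[OF _ g]) (rule eq)
  then have "(\<Sum>k\<in>I. (w k * g (B k)) * A k x) = (\<Sum>k\<in>J. (w' k * g (B' k)) * A' k x)" for x
    by (simp add: mult_ac)
  from sum_functional_eq[where A = A and A' = A', OF this f] show ?thesis by (simp add: mult_ac)
qed

lemma tensor_eq_if_pointwise:
  fixes A A' :: "'i \<Rightarrow> 'x \<Rightarrow> real" and B B' :: "'i \<Rightarrow> 'y \<Rightarrow> real" and C C' :: "'i \<Rightarrow> 'z \<Rightarrow> real"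
  assumes eq: "\<And>x y z. (\<Sum>k\<in>I. w k * A k x * B k y * C k z) = (\<Sum>k\<in>I. w' k * A' k x * B' k y * C' k z)"
  shows "tensor_eq I w A B C w' A' B' C'"
  unfolding tensor_eq_def
proof (intro allI impI)
  fix f :: "('x \<Rightarrow> real) \<Rightarrow> real" and g :: "('y \<Rightarrow> real) \<Rightarrow> real" and h :: "('z \<Rightarrow> real) \<Rightarrow> real"
  assume lin: "linear f" "linear g" "linear h"
  have "(\<Sum>k\<in>I. (w k * A k x) * g (B k) * h (C k)) = (\<Sum>k\<in>I. (w' k * A' k x) * g (B' k) * h (C' k))" for x
    by (rule bilinear_eq_if_pointwise[OF _ lin(2,3)]) (rule eq)
  then have "(\<Sum>k\<in>I. (w k * g (B k) * h (C k)) * A k x) = (\<Sum>k\<in>I. (w' k * g (B' k) * h (C' k)) * A' k x)" for x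
    by (simp add: mult_ac)
  from sum_functional_eq[where A = A and A' = A', OF this lin(1)]
  show "(\<Sum>k\<in>I. w k * f (A k) * g (B k) * h (C k)) = (\<Sum>k\<in>I. w' k * f (A' k) * g (B' k) * h (C' k))"
    by (simp add: mult_ac)
qed

text \<open>On the support \<open>L\<close> of a linear relation the products give a vanishing
  bilinear sum, so the rank bound with an empty right side applies; with
  \<open>card L \<le> a + b - 1\<close> it forces \<open>L\<close> to be empty. It suffices that
  \<open>E\<close> attains all the products among its values.\<close>

lemma krank_ge_product:
  fixes A :: "'i \<Rightarrow> 'x \<Rightarrow> real" and B :: "'i \<Rightarrow> 'y \<Rightarrow> real" and E :: "'i \<Rightarrow> 'z \<Rightarrow> real"
  assumes A: "krank_ge I a A" "1 \<le> a" and B: "krank_ge I b B" "1 \<le> b"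
    and E: "\<And>x y. \<exists>z. \<forall>k\<in>I. E k z = A k x * B k y"
  shows "krank_ge I (a + b - 1) E"
  unfolding krank_ge_def lin_indep_family_def
proof (intro allI impI)
  fix K c
  assume K: "K \<subseteq> I \<and> finite K \<and> card K \<le> a + b - 1" and c: "(\<Sum>k\<in>K. c k *\<^sub>R E k) = 0"
  define L where "L = {k\<in>K. c k \<noteq> 0}"
  have LI: "L \<subseteq> I" "finite L" using K by (auto simp: L_def)
  have "(\<Sum>k\<in>L. c k * A k x * B k y) = 0" for x y
  proof -
    obtain z where z: "\<forall>k\<in>I. E k z = A k x * B k y" using E by blast
    have "(\<Sum>k\<in>L. c k * A k x * B k y) = (\<Sum>k\<in>K. c k * E k z)"
      using K z by (intro sum.mono_neutral_cong_left) (auto simp: L_def subset_iff)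
    also have "\<dots> = (\<Sum>k\<in>K. c k *\<^sub>R E k) z" by (simp add: sum_fun_apply scaleR_fun_def)
    finally show ?thesis using c by simp
  qed
  then have pt: "(\<Sum>k\<in>L. c k * A k x * B k y) = (\<Sum>k\<in>{}. c k * A k x * B k y)" for x y by simp
  have "min a (card L) + min b (card L) \<le> card L + card ({} :: 'i set)"
  proof (rule tensor_rank_bound[where A = A and B = B])
    show "krank_ge L a A" using A(1) LI(1) by (rule krank_ge_subset)
    show "krank_ge L b B" using B(1) LI(1) by (rule krank_ge_subset)
    show "c k \<noteq> 0" if "k \<in> L" for k using that by (simp add: L_def)
    show "(\<Sum>k\<in>L. c k * f (A k) * g (B k)) = (\<Sum>k\<in>{}. c k * f (A k) * g (B k))"
      if "linear f" "linear g" for f g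
      using pt that by (rule bilinear_eq_if_pointwise)
  qed (use LI in auto)
  moreover have "card L \<le> card K" using K by (intro card_mono) (auto simp: L_def)
  ultimately have "card L = 0" using A(2) B(2) K by (auto simp: min_def split: if_splits)
  then show "\<forall>k\<in>K. c k = 0" using LI by (auto simp: L_def)
qed

section \<open>Mixtures of product measures\<close>

text \<open>\<^const>\<open>measure\<close> vanishes on non-measurable sides \<open>E j\<close>, so \<open>E\<close> may range over all
  families of sets and no measurability has to be tracked.\<close>

definition box_measure :: "(nat \<Rightarrow> nat \<Rightarrow> real measure) \<Rightarrow> nat set \<Rightarrow> nat \<Rightarrow> (nat \<Rightarrow> real set) \<Rightarrow> real" where
  "box_measure M S k E = (\<Prod>j\<in>S. measure (M k j) (E j))"

lemma mixture_rep_marginal: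
  assumes "mixture_rep m d w M" "k \<in> {1..m}" "j \<in> {1..d}"
  shows "prob_space (M k j)" "sets (M k j) = sets borel" "measure (M k j) UNIV = 1"
proof -
  show *: "prob_space (M k j)" "sets (M k j) = sets borel"
    using assms by (auto simp: mixture_rep_def)
  from sets_eq_imp_space_eq[OF *(2)] have "space (M k j) = UNIV" by simp
  with prob_space.prob_space[OF *(1)] show "measure (M k j) UNIV = 1" by simp
qed

lemma lin_indep_measures_imp_family:
  assumes "lin_indep_measures K N"
  shows "lin_indep_family K (\<lambda>k. measure (N k))"
  unfolding lin_indep_family_def
proof (intro allI impI)
  fix c assume c: "(\<Sum>k\<in>K. c k *\<^sub>R measure (N k)) = 0"
  have "(\<Sum>k\<in>K. c k * measure (N k) A) = 0" for A
    using fun_cong[OF c, of A] by (simp add: sum_fun_apply scaleR_fun_def)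
  with assms show "\<forall>k\<in>K. c k = 0" unfolding lin_indep_measures_def by blast
qed

text \<open>Total mass 1 gives 1-independence, so the maximum is over a nonempty set. Since the
  maximum is at most \<open>m\<close>, a smaller index set extends to one of exactly that size, and
  independence passes back to the subset.\<close>

lemma Ind_var_props:
  assumes R: "mixture_rep m d w M" and m: "1 \<le> m" and j: "j \<in> {1..d}"
  shows "1 \<le> Ind_var m M j" "krank_ge {1..m} (Ind_var m M j) (\<lambda>k. measure (M k j))"
proof -
  let ?S = "{l. l \<le> m \<and> l_independent m M l j}"
  have fin: "finite ?S" by (rule finite_subset[of _ "{..m}"]) auto
  have "l_independent m M 1 j"
    unfolding l_independent_def lin_indep_measures_def
  proof (intro allI impI ballI)
    fix K c k
    assume K: "K \<subseteq> {1..m} \<and> card K = 1" and k: "k \<in> K"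
      and c: "\<forall>A\<in>sets borel. (\<Sum>k\<in>K. c k * measure (M k j) A) = 0"
    from K k have "K = {k}" by (metis card_1_singletonE singletonD)
    with c mixture_rep_marginal(3)[OF R _ j, of k] K show "c k = 0" by force
  qed
  then have one: "1 \<in> ?S" using m by simp
  then show "1 \<le> Ind_var m M j" unfolding Ind_var_def using fin by (intro Max_ge) auto
  have "Ind_var m M j \<in> ?S" unfolding Ind_var_def using fin one by (intro Max_in) auto
  then have Ind: "Ind_var m M j \<le> m" "l_independent m M (Ind_var m M j) j" by auto
  show "krank_ge {1..m} (Ind_var m M j) (\<lambda>k. measure (M k j))"
    unfolding krank_ge_def
  proof (intro allI impI)
    fix K assume K: "K \<subseteq> {1..m} \<and> finite K \<and> card K \<le> Ind_var m M j"
    then obtain L where L: "K \<subseteq> L" "L \<subseteq> {1..m}" "card L = Ind_var m M j"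
      using exists_subset_between[of K "Ind_var m M j" "{1..m}"] Ind(1) by auto
    have "lin_indep_family L (\<lambda>k. measure (M k j))"
      using Ind(2) L by (intro lin_indep_measures_imp_family) (simp add: l_independent_def)
    then show "lin_indep_family K (\<lambda>k. measure (M k j))"
      using L(1) by (rule lin_indep_family_subset) (use L(2) finite_subset in blast)
  qed
qed

lemma krank_ge_mono: "krank_ge I n A \<Longrightarrow> n' \<le> n \<Longrightarrow> krank_ge I n' A"
  by (auto simp: krank_ge_def)

text \<open>Each further variable raises the rank bound by its index of independence minus one, up
  to the cap \<open>m\<close>. The inequality on \<open>card S\<close> is carried along to keep the
  natural subtraction from truncating.\<close>

lemma krank_ge_box_measure:
  assumes R: "mixture_rep m d w M" and m: "1 \<le> m" and S: "S \<subseteq> {1..d}"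
  shows "card S \<le> Ind_set m M S \<and>
    krank_ge {1..m} (min m (Ind_set m M S - card S + 1)) (box_measure M S)"
proof -
  have "finite S" using S finite_subset by blast
  then show ?thesis using S
  proof (induction S rule: finite_induct)
    \<comment> \<open>Every empty product is the constant function 1: a single copy is independent,
      which matches the value 1 of \<open>tau\<close> on an empty part.\<close>
    case empty
    have "lin_indep_family K (box_measure M {})" if K: "card K \<le> 1" "finite K" for K
      unfolding lin_indep_family_def
    proof (intro allI impI ballI)
      fix c k assume c: "(\<Sum>k\<in>K. c k *\<^sub>R box_measure M {} k) = 0" and k: "k \<in> K"
      have "card K = 1" using K k by (metis One_nat_def Suc_leI card_gt_0_iff empty_iff le_antisym)
      with k have "K = {k}" by (metis card_1_singletonE singletonD)
      have "box_measure M {} k (\<lambda>_. {}) \<noteq> 0" by (simp add: box_measure_def)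
      then have "box_measure M {} k \<noteq> 0" by auto
      with c \<open>K = {k}\<close> show "c k = 0" by simp
    qed
    with m show ?case by (auto simp: Ind_set_def krank_ge_def)
  next
    case (insert j S)
    then have IH: "card S \<le> Ind_set m M S"
        "krank_ge {1..m} (min m (Ind_set m M S - card S + 1)) (box_measure M S)" by auto
    have j: "j \<in> {1..d}" using insert by auto
    note Ind = Ind_var_props[OF R m j]
    have sets: "Ind_set m M (insert j S) = Ind_var m M j + Ind_set m M S"
        "card (insert j S) = Suc (card S)"
      using insert by (simp_all add: Ind_set_def)
    have "krank_ge {1..m} (min m (Ind_set m M S - card S + 1) + Ind_var m M j - 1) (box_measure M (insert j S))"
    proof (rule krank_ge_product[OF IH(2) _ Ind(2,1)])
      fix x :: "nat \<Rightarrow> real set" and y :: "real set"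
      have "box_measure M (insert j S) k (x(j := y)) = box_measure M S k x * measure (M k j) y" for k
      proof -
        have "(\<Prod>i\<in>S. measure (M k i) ((x(j := y)) i)) = (\<Prod>i\<in>S. measure (M k i) (x i))"
          using insert by (intro prod.cong) auto
        then show ?thesis using insert by (simp add: box_measure_def del: fun_upd_apply) simp
      qed
      then show "\<exists>z. \<forall>k\<in>{1..m}. box_measure M (insert j S) k z = box_measure M S k x * measure (M k j) y"
        by blast
    qed (use m in simp)
    then have "krank_ge {1..m} (min m (Ind_set m M (insert j S) - card (insert j S) + 1)) (box_measure M (insert j S))"
      by (rule krank_ge_mono) (unfold sets, use IH(1) Ind(1) in linarith)
    then show ?case using IH(1) Ind(1) by (simp add: sets)
  qed
qed

lemma krank_ge_tau:
  assumes "mixture_rep m d w M" "1 \<le> m" "S \<subseteq> {1..d}"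
  shows "krank_ge {1..m} (nat (tau m M S)) (box_measure M S)" "1 \<le> tau m M S"
proof -
  note K = krank_ge_box_measure[OF assms]
  have "tau m M S = int (min m (Ind_set m M S - card S + 1))"
    unfolding tau_def using conjunct1[OF K] by linarith
  then show "krank_ge {1..m} (nat (tau m M S)) (box_measure M S)" "1 \<le> tau m M S"
    using K assms(2) by simp_all
qed

lemma emeasure_mixture_box:
  assumes R: "mixture_rep m d w M" and E: "\<And>j. j \<in> {1..d} \<Longrightarrow> E j \<in> sets borel"
  shows "emeasure (mixture m d w M) (Pi\<^sub>E {1..d} E) = ennreal (\<Sum>k\<in>{1..m}. w k * box_measure M {1..d} k E)"
proof -
  have box: "emeasure (Pi\<^sub>M {1..d} (M k)) (Pi\<^sub>E {1..d} E) = ennreal (box_measure M {1..d} k E)"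
    if k: "k \<in> {1..m}" for k
  proof -
    note marg = mixture_rep_marginal[OF R k]
    \<comment> \<open>The locale for products expects a sigma-finite measure at every index, so the
      marginals are completed by point masses outside the coordinate range.\<close>
    define N where "N j = (if j \<in> {1..d} then M k j else return borel 0)" for j
    have N: "prob_space (N j)" for j
      using marg(1) by (auto simp: N_def intro: prob_space_return)
    interpret product_sigma_finite N
      unfolding product_sigma_finite_def using N
      by (auto intro: finite_measure.axioms(1) prob_space.axioms(1))
    have "Pi\<^sub>M {1..d} (M k) = Pi\<^sub>M {1..d} N" by (rule PiM_cong) (auto simp: N_def)
    moreover have "emeasure (Pi\<^sub>M {1..d} N) (Pi\<^sub>E {1..d} E) = (\<Prod>j\<in>{1..d}. emeasure (N j) (E j))"
      using E marg(2) by (intro emeasure_PiM) (auto simp: N_def)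
    ultimately have "emeasure (Pi\<^sub>M {1..d} (M k)) (Pi\<^sub>E {1..d} E) = (\<Prod>j\<in>{1..d}. emeasure (N j) (E j))"
      by simp
    also have "\<dots> = (\<Prod>j\<in>{1..d}. ennreal (measure (M k j) (E j)))"
      using marg(1)
      by (intro prod.cong) (auto simp: N_def finite_measure.emeasure_eq_measure prob_space.axioms(1))
    also have "\<dots> = ennreal (box_measure M {1..d} k E)"
      unfolding box_measure_def by (rule prod_ennreal) simp
    finally show ?thesis .
  qed
  have "Pi\<^sub>E {1..d} E \<in> sets (Pi\<^sub>M {1..d} (\<lambda>_. borel :: real measure))"
    using E by (intro sets_PiM_I_finite) auto
  then have "emeasure (mixture m d w M) (Pi\<^sub>E {1..d} E) =
      (\<Sum>k\<in>{1..m}. ennreal (w k) * ennreal (box_measure M {1..d} k E))"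
    by (simp only: emeasure_mixture[OF R] box cong: sum.cong)
  also have "\<dots> = (\<Sum>k\<in>{1..m}. ennreal (w k * box_measure M {1..d} k E))"
    using R by (intro sum.cong refl ennreal_mult[symmetric])
      (auto simp: mixture_rep_def less_imp_le box_measure_def intro: prod_nonneg)
  also have "\<dots> = ennreal (\<Sum>k\<in>{1..m}. w k * box_measure M {1..d} k E)"
    using R by (intro sum_ennreal)
      (auto simp: mixture_rep_def less_imp_le box_measure_def intro!: prod_nonneg mult_nonneg_nonneg)
  finally show ?thesis .
qed

lemma box_measure_not_measurable:
  assumes "mixture_rep m d w M" "k \<in> {1..m}" "j \<in> {1..d}" "E j \<notin> sets borel"
  shows "box_measure M {1..d} k E = 0"
proof -
  have "measure (M k j) (E j) = 0"
    using assms mixture_rep_marginal(2) by (intro measure_notin_sets) simp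
  with assms(3) show ?thesis unfolding box_measure_def by (intro prod_zero) auto
qed

lemma mixture_eq_imp_box_eq:
  assumes R: "mixture_rep m d w M" and R': "mixture_rep m d w' M'"
    and eq: "mixture m d w' M' = mixture m d w M"
  shows "(\<Sum>k\<in>{1..m}. w k * box_measure M {1..d} k E) = (\<Sum>k\<in>{1..m}. w' k * box_measure M' {1..d} k E)"
proof (cases "\<forall>j\<in>{1..d}. E j \<in> sets borel")
  case True
  have nonneg: "0 \<le> (\<Sum>k\<in>{1..m}. w k * box_measure M {1..d} k E)" if "mixture_rep m d w M" for w M
    using that by (intro sum_nonneg)
      (auto simp: mixture_rep_def less_imp_le box_measure_def intro!: prod_nonneg mult_nonneg_nonneg)
  show ?thesis
    using emeasure_mixture_box[OF R, of E] emeasure_mixture_box[OF R', of E] True eq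
      nonneg[OF R] nonneg[OF R'] by simp
next
  case False
  then obtain j where "j \<in> {1..d}" "E j \<notin> sets borel" by blast
  then show ?thesis
    using box_measure_not_measurable[where j = j and E = E] R R' by (simp add: sum.neutral)
qed

lemma box_measure_UNIV:
  assumes "mixture_rep m d w M" "k \<in> {1..m}" "S \<subseteq> {1..d}"
  shows "box_measure M S k (\<lambda>_. UNIV) = 1"
  unfolding box_measure_def using assms mixture_rep_marginal(3) by (intro prod.neutral) blast

text \<open>A box whose sides are the whole line except for the \<open>j\<close>-th recovers the
  \<open>j\<close>-th marginal, since the other factors have mass 1.\<close>

lemma marginal_eq_if_box_measure_eq:
  assumes R: "mixture_rep m d w M" and R': "mixture_rep m d w' M'"
    and k: "k \<in> {1..m}" "l \<in> {1..m}" and S: "S \<subseteq> {1..d}" and j: "j \<in> S"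
    and eq: "box_measure M S k = box_measure M' S l"
  shows "M k j = M' l j"
proof (rule measure_eqI)
  have jd: "j \<in> {1..d}" using S j by auto
  note marg = mixture_rep_marginal[OF R k(1) jd] and marg' = mixture_rep_marginal[OF R' k(2) jd]
  show "sets (M k j) = sets (M' l j)" using marg marg' by simp
  have box: "box_measure M S k (\<lambda>i. if i = j then X else UNIV) = measure (M k j) X"
    if R: "mixture_rep m d w M" and k: "k \<in> {1..m}" for w M k X
  proof -
    have "box_measure M S k (\<lambda>i. if i = j then X else UNIV) = (\<Prod>i\<in>S. if i = j then measure (M k j) X else 1)"
      unfolding box_measure_def using mixture_rep_marginal(3)[OF R k] S by (intro prod.cong) auto
    also have "\<dots> = measure (M k j) X"
      using j S finite_subset[of S "{1..d}"] by (simp add: prod.delta)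
    finally show ?thesis .
  qed
  fix X
  have "measure (M k j) X = measure (M' l j) X"
    using box[OF R k(1), of X] box[OF R' k(2), of X] eq by simp
  then show "emeasure (M k j) X = emeasure (M' l j) X"
    using marg(1) marg'(1) by (simp add: finite_measure.emeasure_eq_measure prob_space.axioms(1))
qed

lemma box_measure_partition3:
  assumes "partition3 {1..d} S1 S2 S3"
  shows "box_measure M {1..d} k (\<lambda>j. if j \<in> S1 then x j else if j \<in> S2 then y j else z j) =
    box_measure M S1 k x * box_measure M S2 k y * box_measure M S3 k z"
proof -
  let ?E = "\<lambda>j. if j \<in> S1 then x j else if j \<in> S2 then y j else z j"
  have S: "{1..d} = S1 \<union> S2 \<union> S3" "S1 \<inter> S2 = {}" "S1 \<inter> S3 = {}" "S2 \<inter> S3 = {}"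
    using assms by (auto simp: partition3_def)
  then have fin: "finite S1" "finite S2" "finite S3" by (metis finite_Un finite_atLeastAtMost)+
  have "box_measure M {1..d} k ?E = box_measure M S1 k ?E * box_measure M S2 k ?E * box_measure M S3 k ?E"
    unfolding box_measure_def S(1) 
    by (simp only: prod.union_disjoint Int_Un_distrib2 finite_Un fin S(2-4) Un_empty simp_thms)
  also have "box_measure M S1 k ?E = box_measure M S1 k x"
    unfolding box_measure_def by (intro prod.cong) auto
  also have "box_measure M S2 k ?E = box_measure M S2 k y"
    unfolding box_measure_def using S by (intro prod.cong) auto
  also have "box_measure M S3 k ?E = box_measure M S3 k z"
    unfolding box_measure_def using S by (intro prod.cong) auto
  finally show ?thesis .
qed

section \<open>The sufficient condition for identifiability\<close>

lemma identifiable_if_tau_ge: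
  assumes R: "mixture_rep m d w M" and m: "1 \<le> m" and P: "partition3 {1..d} S1 S2 S3"
    and tau: "2 * int m + 2 \<le> tau m M S1 + tau m M S2 + tau m M S3"
  shows "identifiable m d w M"
  unfolding identifiable_def
proof (intro allI impI, elim conjE)
  fix w' M'
  assume R': "mixture_rep m d w' M'" and mix: "mixture m d w' M' = mixture m d w M"
  let ?I = "{1..m}"
  have S: "S1 \<subseteq> {1..d}" "S2 \<subseteq> {1..d}" "S3 \<subseteq> {1..d}" and cover: "{1..d} = S1 \<union> S2 \<union> S3"
    using P by (auto simp: partition3_def)
  have eq: "tensor_eq ?I w (box_measure M S1) (box_measure M S2) (box_measure M S3)
      w' (box_measure M' S1) (box_measure M' S2) (box_measure M' S3)"
  proof (rule tensor_eq_if_pointwise)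
    fix x y z :: "nat \<Rightarrow> real set"
    show "(\<Sum>k\<in>?I. w k * box_measure M S1 k x * box_measure M S2 k y * box_measure M S3 k z) =
        (\<Sum>k\<in>?I. w' k * box_measure M' S1 k x * box_measure M' S2 k y * box_measure M' S3 k z)"
      using mixture_eq_imp_box_eq[OF R R' mix,
          of "\<lambda>j. if j \<in> S1 then x j else if j \<in> S2 then y j else z j"]
      by (simp only: box_measure_partition3[OF P] mult.assoc)
  qed
  have le: "tau m M T \<le> int m" for T by (simp add: tau_def)
  note K = krank_ge_tau[OF R m S(1)] krank_ge_tau[OF R m S(2)] krank_ge_tau[OF R m S(3)]
  have w: "w k \<noteq> 0" "w' k \<noteq> 0" if "k \<in> ?I" for k
    using that R R' unfolding mixture_rep_def by (metis less_irrefl)+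
  have "2 * card ?I + 2 \<le> nat (tau m M S1) + nat (tau m M S2) + nat (tau m M S3)"
    using tau K by simp
  moreover have "nat (tau m M T) \<le> card ?I" for T using le[of T] by simp
  ultimately obtain \<sigma> where \<sigma>: "\<sigma> permutes ?I" and span: "\<And>k. k \<in> ?I \<Longrightarrow>
      box_measure M S1 (\<sigma> k) \<in> span {box_measure M' S1 k} \<and>
      box_measure M S2 (\<sigma> k) \<in> span {box_measure M' S2 k} \<and>
      box_measure M S3 (\<sigma> k) \<in> span {box_measure M' S3 k}"
    using kruskal[OF eq _ w K(1,3,5)] by auto
  have \<sigma>_in: "\<sigma> k \<in> ?I" if "k \<in> ?I" for k using that \<sigma> by (simp only: permutes_in_image)
  \<comment> \<open>Kruskal's theorem determines factors only up to scalars; both sides give mass 1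
    to the full box, which fixes the scalar to 1.\<close>
  have line: "box_measure M T (\<sigma> k) = box_measure M' T k"
    if "box_measure M T (\<sigma> k) \<in> span {box_measure M' T k}" "k \<in> ?I" "T \<subseteq> {1..d}" for k T
  proof -
    from that(1) obtain s where s: "box_measure M T (\<sigma> k) = s *\<^sub>R box_measure M' T k"
      by (auto simp: real_vector.span_singleton)
    from fun_cong[OF s, of "\<lambda>_. UNIV"] have "s = 1"
      using box_measure_UNIV[OF R \<sigma>_in[OF that(2)] that(3)] box_measure_UNIV[OF R' that(2,3)]
      by (simp add: scaleR_fun_def)
    with s show ?thesis by simp
  qed
  have boxes: "box_measure M S1 (\<sigma> k) = box_measure M' S1 k \<and> box_measure M S2 (\<sigma> k) = box_measure M' S2 k \<and>
      box_measure M S3 (\<sigma> k) = box_measure M' S3 k" if "k \<in> ?I" for k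
    using span[OF that] line that S by blast
  have marg: "M (\<sigma> k) j = M' k j" if k: "k \<in> ?I" and j: "j \<in> {1..d}" for k j
  proof -
    note * = marginal_eq_if_box_measure_eq[OF R R' \<sigma>_in[OF k] k]
    from j consider "j \<in> S1" | "j \<in> S2" | "j \<in> S3" using cover by blast
    then show ?thesis
    proof cases
      case 1 then show ?thesis using *[OF S(1)] boxes[OF k] by blast
    next
      case 2 then show ?thesis using *[OF S(2)] boxes[OF k] by blast
    next
      case 3 then show ?thesis using *[OF S(3)] boxes[OF k] by blast
    qed
  qed
  \<comment> \<open>Reindexing the competing mixture by \<open>\<sigma>\<close> gives both sides the
    same factors, so their weights agree. As \<open>\<sigma>\<close> sends competing indices to
    original ones, identifiability is witnessed by its inverse.\<close>
  have weights: "w k = w' (inv \<sigma> k)" if "k \<in> ?I" for k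
    by (rule tensor_eq_weights_unique[OF tensor_eq_permute_right[OF eq \<sigma> boxes] _ K(1,3,5) _ _ _ _ that])
      (use K(2,4,6) tau le[of S3] in auto)
  have inv_in: "inv \<sigma> k \<in> ?I" if "k \<in> ?I" for k
    using that permutes_inv[OF \<sigma>] by (simp only: permutes_in_image)
  have "M k j = M' (inv \<sigma> k) j" if "k \<in> ?I" "j \<in> {1..d}" for k j
    using marg[OF inv_in[OF that(1)] that(2)] permutes_inverses(1)[OF \<sigma>] by simp
  then show "\<exists>\<sigma>. \<sigma> permutes ?I \<and>
      (\<forall>k\<in>?I. w k = w' (\<sigma> k) \<and> (\<forall>j\<in>{1..d}. M k j = M' (\<sigma> k) j))"
    using weights permutes_inv[OF \<sigma>] by blast
qed

section \<open>The non-identifiable example\<close>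

lemma mixture_same_components:
  assumes "mixture_rep m d w (\<lambda>_. N)" "mixture_rep m d w' (\<lambda>_. N)"
  shows "mixture m d w (\<lambda>_. N) = mixture m d w' (\<lambda>_. N)"
proof (rule measure_eqI)
  fix A assume "A \<in> sets (mixture m d w (\<lambda>_. N))"
  then have A: "A \<in> sets (Pi\<^sub>M {1..d} (\<lambda>_. borel :: real measure))" by (simp add: sets_mixture)
  have "(\<Sum>k\<in>{1..m}. ennreal (v k)) = 1" if "mixture_rep m d v (\<lambda>_. N)" for v
  proof -
    have "(\<Sum>k\<in>{1..m}. ennreal (v k)) = ennreal (\<Sum>k\<in>{1..m}. v k)"
      using that by (intro sum_ennreal) (auto simp: mixture_rep_def less_imp_le)
    with that show ?thesis by (simp add: mixture_rep_def)
  qed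
  with assms A show "emeasure (mixture m d w (\<lambda>_. N)) A = emeasure (mixture m d w' (\<lambda>_. N)) A"
    by (simp add: emeasure_mixture sum_distrib_right[symmetric])
qed (simp add: sets_mixture)

lemma Ind_var_same_components:
  "Ind_var m (\<lambda>_. N) j \<le> 1"
proof -
  have "l \<le> 1" if l: "l \<le> m" "l_independent m (\<lambda>_. N) l j" for l
  proof (rule ccontr)
    assume "\<not> l \<le> 1"
    \<comment> \<open>With two or more equal components, the difference of the first two is a
      nontrivial vanishing combination.\<close>
    define c :: "nat \<Rightarrow> real" where "c k = (if k = 1 then 1 else if k = 2 then - 1 else 0)" for k
    from \<open>\<not> l \<le> 1\<close> have "lin_indep_measures {1..l} (\<lambda>_. N j)"
      using l by (auto simp: l_independent_def)
    moreover have "(\<Sum>k\<in>{1..l}. c k * measure (N j) A) = 0" for A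
    proof -
      have "(\<Sum>k\<in>{1..l}. c k * measure (N j) A) =
          (\<Sum>k\<in>{1, 2}. c k * measure (N j) A)"
        using \<open>\<not> l \<le> 1\<close> by (intro sum.mono_neutral_right) (auto simp: c_def)
      then show ?thesis by (simp add: c_def)
    qed
    ultimately have "\<forall>k\<in>{1..l}. c k = 0"
      unfolding lin_indep_measures_def by blast
    with \<open>\<not> l \<le> 1\<close> show False by (auto simp: c_def dest: bspec[of _ _ 1])
  qed
  \<comment> \<open>Independence of the empty family makes the set under \<open>Max\<close>
    nonempty, also when \<open>m\<close> is 0.\<close>
  moreover have "0 \<in> {l. l \<le> m \<and> l_independent m (\<lambda>_. N) l j}"
    by (auto simp: l_independent_def lin_indep_measures_def finite_subset)
  ultimately show ?thesis
    unfolding Ind_var_def by (intro Max.boundedI) (auto intro: finite_subset[of _ "{..m}"])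
qed

lemma tau_same_components_le:
  "tau m (\<lambda>_. N) S \<le> 1"
proof -
  have "Ind_set m (\<lambda>_. N) S \<le> card S * 1"
    unfolding Ind_set_def using sum_bounded_above[of S "Ind_var m (\<lambda>_. N)" 1]
      Ind_var_same_components by simp
  then show ?thesis by (simp add: tau_def)
qed

theorem theorem7:
  fixes m d :: nat
  assumes "m \<ge> 2" and "d \<ge> 1"
  shows
    "(\<forall>w M. mixture_rep m d w M \<and>
        (\<exists>S1 S2 S3. partition3 {1..d} S1 S2 S3 \<and>
           tau m M S1 + tau m M S2 + tau m M S3 \<ge> 2 * int m + 2) \<longrightarrow>
        identifiable m d w M) \<and>
     (\<exists>w M. mixture_rep m d w M \<and> \<not> identifiable m d w M \<and>
        (\<forall>S1 S2 S3. partition3 {1..d} S1 S2 S3 \<longrightarrow>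
           tau m M S1 + tau m M S2 + tau m M S3 \<le> 2 * int m + 1))"
proof (intro conjI allI impI)
  fix w M
  assume "mixture_rep m d w M \<and> (\<exists>S1 S2 S3. partition3 {1..d} S1 S2 S3 \<and>
    tau m M S1 + tau m M S2 + tau m M S3 \<ge> 2 * int m + 2)"
  then show "identifiable m d w M"
    using identifiable_if_tau_ge[of m d w M] assms(1) by auto
next
  define N :: "nat \<Rightarrow> real measure" where "N = (\<lambda>_. return borel 0)"
  define w :: "nat \<Rightarrow> real" where "w = (\<lambda>_. 1 / m)"
  \<comment> \<open>Half of the first uniform weight moves to the second, so the sum is unchanged.
    The new value \<open>1 / (2 * m)\<close> does not occur in \<open>w\<close>, so no permutation
    can match the weights.\<close>
  define w' :: "nat \<Rightarrow> real" where
    "w' = (\<lambda>k. if k = 1 then 1 / (2 * m) else if k = 2 then 3 / (2 * m) else 1 / m)"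
  have N: "prob_space (N j)" "sets (N j) = sets borel" for j
    by (simp_all add: N_def prob_space_return)
  have rep: "mixture_rep m d w (\<lambda>_. N)"
    using assms(1) N by (simp add: mixture_rep_def w_def)
  have "{1..m} = {1, 2} \<union> {3..m}" using assms(1) by auto
  then have "(\<Sum>k\<in>{1..m}. w' k) = (\<Sum>k\<in>{1, 2}. w' k) + (\<Sum>k\<in>{3..m}. w' k)"
    by (simp only:) (subst sum.union_disjoint; auto)
  also have "(\<Sum>k\<in>{3..m}. w' k) = (\<Sum>k\<in>{3..m}. 1 / m)"
    by (intro sum.cong) (auto simp: w'_def)
  also have "(\<Sum>k\<in>{1, 2}. w' k) + \<dots> = 1"
    using assms(1) by (simp add: w'_def of_nat_diff field_simps)
  finally have rep': "mixture_rep m d w' (\<lambda>_. N)"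
    using assms(1) N by (simp add: mixture_rep_def w'_def)
  have "\<not> identifiable m d w (\<lambda>_. N)"
  proof
    assume "identifiable m d w (\<lambda>_. N)"
    then obtain \<sigma> where \<sigma>: "\<sigma> permutes {1..m}" "\<forall>k\<in>{1..m}. w k = w' (\<sigma> k)"
      using rep' mixture_same_components[OF rep' rep] unfolding identifiable_def by blast
    have "1 \<in> {1..m}" using assms(1) by simp
    then have "1 \<in> \<sigma> ` {1..m}" using permutes_image[OF \<sigma>(1)] by simp
    then obtain k where "k \<in> {1..m}" "\<sigma> k = 1" by auto
    with \<sigma>(2) have "w k = w' 1" by metis
    then show False using assms(1) by (simp add: w_def w'_def field_simps)
  qed
  \<comment> \<open>Each summand is at most 1, and \<open>3 \<le> 2 * m + 1\<close> because
    \<open>m \<ge> 2\<close>.\<close>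
  moreover have "tau m (\<lambda>_. N) S1 + tau m (\<lambda>_. N) S2 + tau m (\<lambda>_. N) S3 \<le> 2 * int m + 1" for S1 S2 S3
    using tau_same_components_le[of m N S1] tau_same_components_le[of m N S2]
      tau_same_components_le[of m N S3] assms(1) by linarith
  ultimately show "\<exists>w M. mixture_rep m d w M \<and> \<not> identifiable m d w M \<and>
      (\<forall>S1 S2 S3. partition3 {1..d} S1 S2 S3 \<longrightarrow>
        tau m M S1 + tau m M S2 + tau m M S3 \<le> 2 * int m + 1)"
    using rep by blast
qed

end
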